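(* Let $X$ be a Banach space over $\mathbb K\in\{\mathbb R,\mathbb C\}$ with the Daugavet property, and let \[ Y=\bigcap_{j=1}^n \ker f_j\subset X,\qquad W=\operatorname{span}\{f_1,\dots,f_n\}\subset X^*, \] where $f_1,\dots,f_n\in X^*$. Then \[ \lambda(Y,X)=1+\lambda(W,X^* ). \] Moreover, a minimal projection from $X$ onto $Y$ exists if and only if there exists a weak$^*$-continuous minimal projection from $X^*$ onto $W$.
   Context: Projections are bounded linear operators. For a closed subspace $E$ of a Banach space $F$, the projection constant of $E$ in $F$ is $\lambda(E,F)=\inf\{\|P\| : P\colon F\to E,\ P|_E=\mathrm{Id}_E\}$. A minimal projection from $F$ onto $E$ is a projection $P\colon F\to E$ (that is, $P|_E=\mathrm{Id}_E$) with $\|P\|=\lambda(E,F)$, i.e. one attaining this infimum. A Banach space $X$ has the Daugavet property if every (bounded) rank-one operator $T\colon X\to X$ satisfies $\|\mathrm{Id}_X+T\|=1+\|T\|$. Here $X^*$ is the dual of $X$, and "weak$^*$-continuous" for an operator $X^*\to W\subset X^*$, with $W$ finite-dimensional, means continuous from the weak$^*$ topology $\sigma(X^*,X)$ on $X^*$ to the unique Hausdorff vector space topology of $W$. *)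

theory Defs
  imports "HOL-Analysis.Analysis"
begin

text \<open>
  The scalar field is a type \<open>'k\<close> that is, up to an isometric field isomorphism, either \<open>\<real>\<close> or \<open>\<complex>\<close>:
  there is a norm-preserving (hence injective) ring homomorphism into \<open>\<complex>\<close> whose range is
  \<open>\<real>\<close> or all of \<open>\<complex>\<close>.
\<close>

class real_or_complex = real_normed_field +
  assumes real_or_complex:
    "\<exists>\<phi> :: 'a \<Rightarrow> complex.
       (\<forall>x y. \<phi> (x + y) = \<phi> x + \<phi> y) \<and> (\<forall>x y. \<phi> (x * y) = \<phi> x * \<phi> y) \<and>
       (\<forall>x. cmod (\<phi> x) = norm x) \<and> (range \<phi> = \<real> \<or> range \<phi> = UNIV)"

instance real :: real_or_complex
proof
  show "\<exists>\<phi> :: real \<Rightarrow> complex.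
       (\<forall>x y. \<phi> (x + y) = \<phi> x + \<phi> y) \<and> (\<forall>x y. \<phi> (x * y) = \<phi> x * \<phi> y) \<and>
       (\<forall>x. cmod (\<phi> x) = norm x) \<and> (range \<phi> = \<real> \<or> range \<phi> = UNIV)"
    by (rule exI[of _ complex_of_real]) (simp add: Reals_def)
qed

instance complex :: real_or_complex
proof
  show "\<exists>\<phi> :: complex \<Rightarrow> complex.
       (\<forall>x y. \<phi> (x + y) = \<phi> x + \<phi> y) \<and> (\<forall>x y. \<phi> (x * y) = \<phi> x * \<phi> y) \<and>
       (\<forall>x. cmod (\<phi> x) = norm x) \<and> (range \<phi> = \<real> \<or> range \<phi> = UNIV)"
    by (rule exI[of _ "\<lambda>x. x"]) simp
qed

text \<open>
  A Banach space over \<open>'k\<close>: class \<open>banach\<close> supplies the complete norm and the underlying real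
  structure, \<open>scale\<close> the multiplication by scalars from \<open>'k\<close>.
\<close>

locale banach_space_over = vector_space scale
  for scale :: "'k::real_or_complex \<Rightarrow> 'a::banach \<Rightarrow> 'a" +
  assumes norm_scale: "norm (scale c x) = norm c * norm x"
    and scale_of_real: "scale (of_real r) x = r *\<^sub>R x"

lemma banach_space_over_real: "banach_space_over ((*\<^sub>R) :: real \<Rightarrow> 'a::banach \<Rightarrow> 'a)"
  by unfold_locales (auto simp: algebra_simps)

lemma banach_space_over_complex: "banach_space_over ((*) :: complex \<Rightarrow> complex \<Rightarrow> complex)"
  by unfold_locales (auto simp: algebra_simps norm_mult scaleR_conv_of_real)

text \<open>
  Normed spaces occur below as linear subspaces \<open>F\<close>, \<open>E\<close> of a type \<open>'b\<close>, which makes it possible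
  to treat \<open>X\<close> and its dual uniformly. Operators are functions on \<open>'b\<close>; their values outside the
  domain \<open>F\<close> are irrelevant.
\<close>

definition bounded_operator ::
  "('k \<Rightarrow> 'b \<Rightarrow> 'b) \<Rightarrow> 'b set \<Rightarrow> 'b set \<Rightarrow> ('b::real_normed_vector \<Rightarrow> 'b) \<Rightarrow> bool"
  where "bounded_operator s F E T \<longleftrightarrow>
    (\<forall>x\<in>F. T x \<in> E) \<and>
    (\<forall>x\<in>F. \<forall>y\<in>F. T (x + y) = T x + T y) \<and>
    (\<forall>c. \<forall>x\<in>F. T (s c x) = s c (T x)) \<and>
    (\<exists>B. \<forall>x\<in>F. norm (T x) \<le> B * norm x)"

definition onorm_on :: "'b set \<Rightarrow> ('b::real_normed_vector \<Rightarrow> 'b) \<Rightarrow> real"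
  where "onorm_on F T = (SUP x\<in>F. norm (T x) / norm x)"

lemma onorm_on_UNIV: "onorm_on UNIV T = onorm T"
  by (simp add: onorm_on_def onorm_def)

definition projection ::
  "('k \<Rightarrow> 'b \<Rightarrow> 'b) \<Rightarrow> 'b set \<Rightarrow> 'b set \<Rightarrow> ('b::real_normed_vector \<Rightarrow> 'b) \<Rightarrow> bool"
  where "projection s E F P \<longleftrightarrow> bounded_operator s F E P \<and> (\<forall>x\<in>E. P x = x)"

text \<open>
  The infimum is taken in \<open>\<real>\<close>, so it is meaningful only if \<open>E\<close> is complemented in \<open>F\<close>. This holds
  whenever \<open>E\<close> is closed of finite dimension or of finite codimension.
\<close>

definition projection_constant ::
  "('k \<Rightarrow> 'b \<Rightarrow> 'b) \<Rightarrow> 'b::real_normed_vector set \<Rightarrow> 'b set \<Rightarrow> real"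
  where "projection_constant s E F = Inf {onorm_on F P |P. projection s E F P}"

definition minimal_projection ::
  "('k \<Rightarrow> 'b \<Rightarrow> 'b) \<Rightarrow> 'b set \<Rightarrow> 'b set \<Rightarrow> ('b::real_normed_vector \<Rightarrow> 'b) \<Rightarrow> bool"
  where "minimal_projection s E F P \<longleftrightarrow>
    projection s E F P \<and> onorm_on F P = projection_constant s E F"

definition daugavet_property ::
  "('k::real_or_complex \<Rightarrow> 'a::banach \<Rightarrow> 'a) \<Rightarrow> bool"
  where "daugavet_property s \<longleftrightarrow>
    (\<forall>T. bounded_operator s UNIV UNIV T \<and> vector_space.dim s (range T) = 1 \<longrightarrow>
      onorm (\<lambda>x. x + T x) = 1 + onorm T)"

text \<open>
  The dual of \<open>X\<close> is the set of those bounded real-linear maps into \<open>'k\<close> that are \<open>'k\<close>-linear. It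
  inherits the operator norm of \<open>'a \<Rightarrow>\<^sub>L 'k\<close>. On the dual, the topology of pointwise convergence is
  the weak* topology.
\<close>

definition dual_space ::
  "('k::real_or_complex \<Rightarrow> 'a::banach \<Rightarrow> 'a) \<Rightarrow> ('a \<Rightarrow>\<^sub>L 'k) set"
  where "dual_space s = {f. \<forall>c x. blinfun_apply f (s c x) = c * blinfun_apply f x}"

definition dual_scale ::
  "'k::real_or_complex \<Rightarrow> ('a::banach \<Rightarrow>\<^sub>L 'k) \<Rightarrow> ('a \<Rightarrow>\<^sub>L 'k)"
  where "dual_scale c f = blinfun_mult_right c o\<^sub>L f"

lemma dual_scale_apply: "blinfun_apply (dual_scale c f) x = c * blinfun_apply f x"
  by (simp add: dual_scale_def)

lemma vector_space_dual_scale: "vector_space dual_scale"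
  by unfold_locales
    (auto intro!: blinfun_eqI simp: dual_scale_apply blinfun.add_left algebra_simps)

definition weak_star_topology ::
  "('k::real_or_complex \<Rightarrow> 'a::banach \<Rightarrow> 'a) \<Rightarrow> ('a \<Rightarrow>\<^sub>L 'k) topology"
  where "weak_star_topology s = subtopology strong_operator_topology (dual_space s)"

text \<open>
  The unique Hausdorff vector space topology of a finite-dimensional \<open>W\<close> is its norm topology,
  \<open>top_of_set W\<close>.
\<close>

definition weak_star_continuous ::
  "('k::real_or_complex \<Rightarrow> 'a::banach \<Rightarrow> 'a) \<Rightarrow> ('a \<Rightarrow>\<^sub>L 'k) set \<Rightarrow>
    (('a \<Rightarrow>\<^sub>L 'k) \<Rightarrow> ('a \<Rightarrow>\<^sub>L 'k)) \<Rightarrow> bool"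
  where "weak_star_continuous s W P \<longleftrightarrow>
    continuous_map (weak_star_topology s) (top_of_set W) P"

end

theory Submission
  imports Defs
begin

text \<open>
  Projections \<open>P\<close> onto \<open>Y\<close> correspond to projections \<open>T = Id - P\<close> with kernel \<open>Y\<close>. Such a \<open>T\<close> has finite
  rank, and its dual map \<open>g \<mapsto> g \<circ> T\<close> is a weak* continuous projection of the dual onto the annihilator
  of \<open>Y\<close>, which is \<open>W\<close>; every weak* continuous projection onto \<open>W\<close> arises in this way
  (\<open>weak_star_continuous_projection_is_dual_map\<close>), and \<open>T\<close> and its dual map have the same norm.

  The norm of \<open>P = Id - T\<close> is \<open>1 + norm T\<close>, because the Daugavet property extends from
  rank-one operators to compact ones (\<open>Daugavet_compact_operator\<close>): slices of the unit ball can be shrunk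
  until their points are in the position of largest norm relative to all points of a finite net of the
  image of \<open>T\<close>. Hence the projection constant of \<open>Y\<close> is one more than the infimum of the norms of the weak*
  continuous projections onto \<open>W\<close>, and both infima are attained or neither.

  It remains to see that projections onto \<open>W\<close> without weak* continuity do not have a smaller infimum
  (\<open>weak_star_continuous_approximation\<close>). This is an instance of the principle of local reflexivity.
  Up to a small relative error, the norm of a projection with kernel \<open>Y\<close> is determined by its values
  at finitely many points, so that the infimum of these norms becomes the distance of a point from a
  subspace in a space of sequences with the supremum norm; a functional that computes this distance is
  bounded with the help of the given projection onto \<open>W\<close>. The functionals come from the Hahn-Banach theorem,
  which is proved for sublinear functionals on real vector spaces and transferred to the scalar field by
  taking real parts.
\<close>

section \<open>The Hahn-Banach theorem\<close>

text \<open>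
  Instead of extending functionals from subspaces step by step, the proof looks for a minimal
  element below a given sublinear functional: minimal sublinear functionals are linear.
\<close>

definition sublinear :: "('b::real_vector \<Rightarrow> real) \<Rightarrow> bool"
  where "sublinear p \<longleftrightarrow>
    (\<forall>x y. p (x + y) \<le> p x + p y) \<and> (\<forall>c x. 0 \<le> c \<longrightarrow> p (c *\<^sub>R x) = c * p x)"

lemma sublinearI:
  assumes "\<And>x y. p (x + y) \<le> p x + p y"
    and "\<And>c x. 0 < c \<Longrightarrow> p (c *\<^sub>R x) \<le> c * p x"
    and "p 0 = 0"
  shows "sublinear p"
proof -
  have "p (c *\<^sub>R x) = c * p x" if c: "0 \<le> c" for c x
  proof (cases "c = 0")
    case False
    then have c0: "0 < c" using c by simp
    have "p x = p (inverse c *\<^sub>R (c *\<^sub>R x))" using c0 by simp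
    also have "\<dots> \<le> inverse c * p (c *\<^sub>R x)" using c0 by (intro assms(2)) simp
    finally have "c * p x \<le> c * (inverse c * p (c *\<^sub>R x))" 
      by (rule mult_left_mono) (use c in simp)
    moreover have "c * (inverse c * p (c *\<^sub>R x)) = p (c *\<^sub>R x)" using c0 by simp
    ultimately have "c * p x \<le> p (c *\<^sub>R x)" by simp
    then show ?thesis using assms(2)[OF c0, of x] by simp
  qed (use assms(3) in simp)
  then show ?thesis using assms(1) by (auto simp: sublinear_def)
qed

lemma sublinear_add: "sublinear p \<Longrightarrow> p (x + y) \<le> p x + p y"
  and sublinear_scale: "sublinear p \<Longrightarrow> 0 \<le> c \<Longrightarrow> p (c *\<^sub>R x) = c * p x"
  by (auto simp: sublinear_def)

lemma sublinear_0: "sublinear p \<Longrightarrow> p 0 = 0"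
  using sublinear_scale[of p 0 0] by simp

lemma sublinear_minus: "sublinear p \<Longrightarrow> - p (- x) \<le> p x"
  using sublinear_add[of p x "- x"] sublinear_0[of p] by simp

text \<open>
  The infimum forces the value at \<open>- v\<close> down to \<open>- q v\<close>. It serves two purposes: a minimal \<open>q\<close>
  cannot be lowered, which makes it odd and hence linear; and every linear functional below
  \<open>lowered q v\<close> agrees with \<open>q\<close> at \<open>v\<close>.
\<close>

definition lowered :: "('b::real_vector \<Rightarrow> real) \<Rightarrow> 'b \<Rightarrow> 'b \<Rightarrow> real"
  where "lowered q v x = (INF t\<in>{0..}. q (x + t *\<^sub>R v) - t * q v)"

lemma
  assumes q: "sublinear q"
  shows sublinear_lowered: "sublinear (lowered q v)"
    and lowered_le: "lowered q v x \<le> q x"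
    and lowered_uminus: "lowered q v (- v) \<le> - q v"
proof -
  have low: "- q (- x) \<le> q (x + t *\<^sub>R v) - t * q v" if "0 \<le> t" for t x
    using sublinear_add[OF q, of "x + t *\<^sub>R v" "- x"] sublinear_scale[OF q that, of v] by simp
  have bdd: "bdd_below ((\<lambda>t. q (x + t *\<^sub>R v) - t * q v) ` {0..})" for x
    by (rule bdd_belowI2[where m = "- q (- x)"]) (use low in auto)
  have le: "lowered q v x \<le> q (x + t *\<^sub>R v) - t * q v" if "0 \<le> t" for t x
    unfolding lowered_def by (rule cINF_lower[OF bdd]) (use that in auto)
  show "lowered q v x \<le> q x" for x using le[of 0 x] by simp
  show "lowered q v (- v) \<le> - q v" using le[of 1 "- v"] by (simp add: sublinear_0[OF q])
  show "sublinear (lowered q v)"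
  proof (rule sublinearI)
    fix x y
    have *: "lowered q v (x + y) - (q (y + s *\<^sub>R v) - s * q v) \<le> q (x + t *\<^sub>R v) - t * q v"
      if "0 \<le> s" "0 \<le> t" for s t
      using le[of "t + s" "x + y"] that sublinear_add[OF q, of "x + t *\<^sub>R v" "y + s *\<^sub>R v"]
      by (simp add: algebra_simps)
    have "lowered q v (x + y) - (q (y + s *\<^sub>R v) - s * q v) \<le> lowered q v x" if "0 \<le> s" for s
      unfolding lowered_def[of q v x] by (rule cINF_greatest) (use * that in auto)
    then have "lowered q v (x + y) - lowered q v x \<le> q (y + s *\<^sub>R v) - s * q v" if "0 \<le> s" for s
      using that by (smt (verit))
    then have "lowered q v (x + y) - lowered q v x \<le> lowered q v y"
      unfolding lowered_def[of q v y] by (intro cINF_greatest) auto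
    then show "lowered q v (x + y) \<le> lowered q v x + lowered q v y" by simp
  next
    fix c :: real and x
    assume c: "0 < c"
    have "lowered q v (c *\<^sub>R x) / c \<le> q (x + t *\<^sub>R v) - t * q v" if "0 \<le> t" for t
      using le[of "c * t" "c *\<^sub>R x"] c that sublinear_scale[OF q, of c "x + t *\<^sub>R v"]
      by (simp add: scaleR_add_right field_simps)
    then have "lowered q v (c *\<^sub>R x) / c \<le> lowered q v x"
      unfolding lowered_def[of q v x] by (intro cINF_greatest) auto
    then show "lowered q v (c *\<^sub>R x) \<le> c * lowered q v x" using c by (simp add: field_simps)
  next
    have "0 \<le> lowered q v 0"
      unfolding lowered_def using low[of _ 0] sublinear_0[OF q] by (intro cINF_greatest) auto
    then show "lowered q v 0 = 0" using le[of 0 0] sublinear_0[OF q] by simp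
  qed
qed

text \<open>
  Zorn's lemma applies because the pointwise infimum of a chain is again sublinear; it is finite,
  since each sublinear \<open>q\<close> below \<open>p\<close> satisfies \<open>- p (- x) \<le> q x\<close>.
\<close>

lemma minimal_sublinear_exists:
  fixes p :: "'b::real_vector \<Rightarrow> real"
  assumes p: "sublinear p"
  obtains q where "sublinear q" "q \<le> p" "\<And>r. sublinear r \<Longrightarrow> r \<le> q \<Longrightarrow> r = q"
proof -
  define A where "A = {q. sublinear q \<and> q \<le> p}"
  have "\<exists>m\<in>A. \<forall>a\<in>A. m \<ge> a \<longrightarrow> a = m"
  proof (rule predicate_Zorn)
    show "partial_order_on A (relation_of (\<lambda>x y. x \<ge> y) A)"
      by (rule partial_order_on_relation_ofI) auto
    fix C assume C: "C \<in> Chains (relation_of (\<lambda>x y. x \<ge> y) A)"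
    show "\<exists>u\<in>A. \<forall>a\<in>C. u \<le> a"
    proof (cases "C = {}")
      case True
      then show ?thesis using p by (auto simp: A_def)
    next
      case False
      have CA: "q \<in> A" if "q \<in> C" for q using C that by (auto simp: Chains_def relation_of_def)
      have tot: "q \<le> r \<or> r \<le> q" if "q \<in> C" "r \<in> C" for q r
        using C that by (auto simp: Chains_def relation_of_def)
      have sub: "sublinear q" and qp: "q x \<le> p x" if "q \<in> C" for q x
        using CA[OF that] by (auto simp: A_def le_fun_def)
      have low: "- p (- x) \<le> q x" if "q \<in> C" for q x
        using sublinear_minus[OF sub[OF that], of x] qp[OF that, of "- x"] by simp
      define u where "u x = (INF q\<in>C. q x)" for x
      have bdd: "bdd_below ((\<lambda>q. q x) ` C)" for x
        by (rule bdd_belowI2) (rule low)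
      have le: "u x \<le> q x" if "q \<in> C" for q x
        unfolding u_def by (rule cINF_lower[OF bdd that])
      have "sublinear u"
      proof (rule sublinearI)
        fix x y
        have *: "u (x + y) - r y \<le> q x" if qr: "q \<in> C" "r \<in> C" for q r
        proof -
          obtain m where m: "m \<in> C" "m \<le> q" "m \<le> r" using tot[OF qr] qr by blast
          have "u (x + y) \<le> m x + m y"
            using le[OF m(1), of "x + y"] sublinear_add[OF sub[OF m(1)], of x y] by simp
          then show ?thesis using m(2,3) by (smt (verit) le_fun_def)
        qed
        have "u (x + y) - r y \<le> u x" if "r \<in> C" for r
          unfolding u_def[of x] by (rule cINF_greatest[OF False]) (use * that in auto)
        then have "u (x + y) - u x \<le> r y" if "r \<in> C" for r using that by (smt (verit))
        then have "u (x + y) - u x \<le> u y"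
          unfolding u_def[of y] by (intro cINF_greatest[OF False]) auto
        then show "u (x + y) \<le> u x + u y" by simp
      next
        fix c :: real and x
        assume c: "0 < c"
        have "u (c *\<^sub>R x) / c \<le> q x" if "q \<in> C" for q
          using le[OF that, of "c *\<^sub>R x"] sublinear_scale[OF sub[OF that], of c x] c
          by (simp add: field_simps)
        then have "u (c *\<^sub>R x) / c \<le> u x"
          unfolding u_def[of x] by (intro cINF_greatest[OF False]) auto
        then show "u (c *\<^sub>R x) \<le> c * u x" using c by (simp add: field_simps)
      next
        have "(\<lambda>q. q 0) ` C = (\<lambda>q. 0) ` C"
          by (rule image_cong) (use sub sublinear_0 in auto)
        also have "\<dots> = {0}" using False by auto
        finally show "u 0 = 0" by (simp add: u_def)
      qed
      moreover have "u \<le> p"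
        using False le qp by (meson le_funI order_trans ex_in_conv)
      ultimately show ?thesis using le by (auto simp: A_def le_fun_def)
    qed
  qed
  then obtain m where m: "m \<in> A" "\<And>a. a \<in> A \<Longrightarrow> a \<le> m \<Longrightarrow> a = m" by blast
  show ?thesis
    by (rule that[of m]) (use m in \<open>auto simp: A_def\<close>)
qed

lemma minimal_sublinear_linear:
  fixes q :: "'b::real_vector \<Rightarrow> real"
  assumes q: "sublinear q" and min: "\<And>r. sublinear r \<Longrightarrow> r \<le> q \<Longrightarrow> r = q"
  shows "linear q"
proof -
  have "lowered q v = q" for v
    by (rule min[OF sublinear_lowered[OF q]]) (simp add: le_fun_def lowered_le[OF q])
  then have neg: "q (- v) = - q v" for v
    using lowered_uminus[OF q, of v] sublinear_minus[OF q, of v] by simp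
  show ?thesis
  proof (rule linearI)
    fix x y
    have "q (- (x + y)) \<le> q (- x) + q (- y)" using sublinear_add[OF q, of "- x" "- y"] by simp
    then show "q (x + y) = q x + q y"
      using sublinear_add[OF q, of x y] by (simp only: neg)
  next
    fix c x
    show "q (c *\<^sub>R x) = c *\<^sub>R q x"
    proof (cases "0 \<le> c")
      case True then show ?thesis using sublinear_scale[OF q] by simp
    next
      case False
      then have "q (- (c *\<^sub>R x)) = - c * q x" using sublinear_scale[OF q, of "- c" x] by simp
      then show ?thesis by (simp add: neg)
    qed
  qed
qed

theorem Hahn_Banach_sublinear:
  fixes p :: "'b::real_vector \<Rightarrow> real"
  assumes p: "sublinear p"
  obtains F where "linear F" "\<And>x. F x \<le> p x" "F v = p v"
proof -
  obtain q where q: "sublinear q" "q \<le> lowered p v" "\<And>r. sublinear r \<Longrightarrow> r \<le> q \<Longrightarrow> r = q"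
    using minimal_sublinear_exists[OF sublinear_lowered[OF p, of v]] by blast
  have lin: "linear q" by (rule minimal_sublinear_linear[OF q(1,3)])
  have le: "q x \<le> p x" for x using q(2) lowered_le[OF p, of v x] by (meson le_funD order_trans)
  have "q (- v) \<le> - p v" using q(2) lowered_uminus[OF p, of v] by (meson le_funD order_trans)
  then have "p v \<le> q v" using linear_neg[OF lin, of v] by simp
  with le[of v] have "q v = p v" by simp
  with lin le show ?thesis by (rule that)
qed

lemma sublinear_norm: "sublinear norm"
  by (simp add: sublinear_def norm_triangle_ineq)

lemma sublinear_infdist_subspace:
  fixes D :: "'b::real_normed_vector set"
  assumes D: "subspace D"
  shows "sublinear (\<lambda>z. infdist z D)"
proof (rule sublinearI)
  have ne: "D \<noteq> {}" using subspace_0[OF D] by blast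
  have near: "\<exists>d\<in>D. dist z d < infdist z D + e" if "0 < e" for z e
    using cInf_lessD[of "dist z ` D" "infdist z D + e"] that ne by (auto simp: infdist_notempty)
  fix x y
  show "infdist (x + y) D \<le> infdist x D + infdist y D"
  proof (rule field_le_epsilon)
    fix e :: real assume "0 < e"
    then obtain a b where ab: "a \<in> D" "dist x a < infdist x D + e/2" "b \<in> D" "dist y b < infdist y D + e/2"
      using near[of "e/2" x] near[of "e/2" y] by auto
    have "infdist (x + y) D \<le> dist (x + y) (a + b)"
      by (rule infdist_le) (rule subspace_add[OF D ab(1,3)])
    also have "\<dots> \<le> dist x a + dist y b" unfolding dist_norm by (rule norm_diff_triangle_ineq)
    finally show "infdist (x + y) D \<le> infdist x D + infdist y D + e" using ab by linarith
  qed
next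
  have ne: "D \<noteq> {}" using subspace_0[OF D] by blast
  fix c :: real and x assume c: "0 < c"
  have "infdist (c *\<^sub>R x) D / c \<le> dist x d" if "d \<in> D" for d
  proof -
    have "infdist (c *\<^sub>R x) D \<le> dist (c *\<^sub>R x) (c *\<^sub>R d)"
      by (rule infdist_le) (rule subspace_scale[OF D that])
    also have "\<dots> = c * dist x d"
      using c by (simp add: dist_norm flip: scaleR_diff_right)
    finally show ?thesis using c by (simp add: field_simps)
  qed
  then have "infdist (c *\<^sub>R x) D / c \<le> infdist x D"
    unfolding infdist_notempty[OF ne] by (intro cINF_greatest[OF ne]) auto
  then show "infdist (c *\<^sub>R x) D \<le> c * infdist x D" using c by (simp add: field_simps)
next
  show "infdist 0 D = 0" using subspace_0[OF D] by simp
qed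

text \<open>
  The distance from a subspace is sublinear, so the previous theorem applied to it gives the
  functional that computes the distance of \<open>v\<close> from \<open>D\<close>.
\<close>

theorem Hahn_Banach_subspace:
  fixes D :: "'b::real_normed_vector set"
  assumes D: "subspace D"
  obtains F where "linear F" "\<And>z. F z \<le> norm z" "\<And>z. z \<in> D \<Longrightarrow> F z = 0" "F v = infdist v D"
proof -
  obtain F where F: "linear F" "\<And>z. F z \<le> infdist z D" "F v = infdist v D"
    using Hahn_Banach_sublinear[OF sublinear_infdist_subspace[OF D]] by blast
  have "F z \<le> norm z" for z
    using F(2)[of z] infdist_le[OF subspace_0[OF D], of z] by simp
  moreover have "F z = 0" if "z \<in> D" for z
    using F(2)[of z] F(2)[of "- z"] that subspace_neg[OF D that] linear_neg[OF F(1), of z] by simp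
  ultimately show ?thesis using F(1,3) that by blast
qed

section \<open>Scalars\<close>

text \<open>
  An isometric ring homomorphism fixes the reals: the distances of the image of a real \<open>r\<close> from \<open>0\<close>
  and from \<open>- 1\<close> are those of \<open>r\<close>, and these two distances already determine a point that has
  the real part \<open>r\<close> and no imaginary part.
\<close>

lemma real_or_complex_embedding:
  "\<exists>\<phi> :: 'k::real_or_complex \<Rightarrow> complex.
     (\<forall>x y. \<phi> (x + y) = \<phi> x + \<phi> y) \<and> (\<forall>x y. \<phi> (x * y) = \<phi> x * \<phi> y) \<and>
     (\<forall>x. cmod (\<phi> x) = norm x) \<and> (\<forall>r. \<phi> (of_real r) = complex_of_real r) \<and>
     (range \<phi> = \<real> \<or> range \<phi> = UNIV)"
proof -
  obtain \<phi> :: "'k \<Rightarrow> complex" where add: "\<And>x y. \<phi> (x + y) = \<phi> x + \<phi> y"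
    and mult: "\<And>x y. \<phi> (x * y) = \<phi> x * \<phi> y"
    and norm: "\<And>x. cmod (\<phi> x) = norm x" and range: "range \<phi> = \<real> \<or> range \<phi> = UNIV"
    using real_or_complex by blast
  have "\<phi> 1 * \<phi> 1 = \<phi> 1" using mult[of 1 1] by simp
  moreover have "\<phi> 1 \<noteq> 0" using norm[of 1] by auto
  ultimately have one: "\<phi> 1 = 1" by simp
  have "\<phi> (of_real r) = complex_of_real r" for r
  proof -
    have "cmod (\<phi> (of_real r)) = \<bar>r\<bar>" by (simp add: norm)
    then have 1: "(Re (\<phi> (of_real r)))\<^sup>2 + (Im (\<phi> (of_real r)))\<^sup>2 = r\<^sup>2"
      by (metis cmod_power2 power2_abs)
    have "cmod (\<phi> (of_real r) + 1) = norm (of_real r + 1 :: 'k)"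
      by (metis add norm one)
    also have "\<dots> = \<bar>r + 1\<bar>" by (metis norm_of_real of_real_1 of_real_add)
    finally have 2: "(Re (\<phi> (of_real r)) + 1)\<^sup>2 + (Im (\<phi> (of_real r)))\<^sup>2 = (r + 1)\<^sup>2"
      by (metis cmod_power2 power2_abs plus_complex.sel one_complex.sel add.right_neutral)
    have "Re (\<phi> (of_real r)) = r" using 1 2 by (simp add: power2_eq_square algebra_simps)
    moreover from this have "Im (\<phi> (of_real r)) = 0" using 1 by simp
    ultimately show ?thesis by (simp add: complex_eq_iff)
  qed
  with add mult norm range show ?thesis by blast
qed

text \<open>
  Over \<open>\<complex>\<close>, \<open>j\<close> is the imaginary unit; over \<open>\<real>\<close>, the choice \<open>j = 0\<close> makes the same formulas valid, so
  the two scalar fields need no separate treatment below.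
\<close>

lemma real_part_exists:
  obtains re :: "'k::real_or_complex \<Rightarrow> real" and j :: 'k
  where "linear re" "\<And>c. \<bar>re c\<bar> \<le> norm c" "\<And>r. re (of_real r) = r"
    "re j = 0" "j = 0 \<or> j * j = - 1"
    "\<And>c. c = of_real (re c) - j * of_real (re (j * c))"
proof -
  obtain \<phi> :: "'k \<Rightarrow> complex" where add: "\<And>x y. \<phi> (x + y) = \<phi> x + \<phi> y"
    and mult: "\<And>x y. \<phi> (x * y) = \<phi> x * \<phi> y"
    and norm: "\<And>x. cmod (\<phi> x) = norm x" and real: "\<And>r. \<phi> (of_real r) = complex_of_real r"
    and range: "range \<phi> = \<real> \<or> range \<phi> = UNIV"
    using real_or_complex_embedding by blast
  have diff: "\<phi> (x - y) = \<phi> x - \<phi> y" for x y using add[of "x - y" y] by simp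
  have inj: "x = y" if "\<phi> x = \<phi> y" for x y using norm[of "x - y"] that by (simp add: diff)
  define re where "re c = Re (\<phi> c)" for c
  have lin: "linear re"
  proof (rule linearI)
    show "re (x + y) = re x + re y" for x y by (simp add: re_def add)
    show "re (r *\<^sub>R x) = r *\<^sub>R re x" for r x
      unfolding re_def scaleR_conv_of_real[of r x] mult real by simp
  qed
  have le: "\<bar>re c\<bar> \<le> norm c" for c using abs_Re_le_cmod[of "\<phi> c"] by (simp add: re_def norm)
  have of_real: "re (of_real r) = r" for r by (simp add: re_def real)
  show ?thesis
  proof (cases "range \<phi> = \<real>")
    case True
    have "c = of_real (re c)" for c
    proof (rule inj)
      have "\<phi> c \<in> \<real>" using True by blast
      then show "\<phi> c = \<phi> (of_real (re c))" by (simp add: real re_def complex_is_Real_iff complex_eq_iff)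
    qed
    then show ?thesis using lin le of_real of_real[of 0] by (intro that[of re 0]) auto
  next
    case False
    then have "range \<phi> = UNIV" using range by blast
    then obtain j where j: "\<phi> j = \<i>" by (metis UNIV_I imageE)
    have "re j = 0" by (simp add: re_def j)
    moreover have "j * j = - 1"
      by (rule inj) (metis (no_types) j mult i_squared of_real_1 of_real_minus real)
    moreover have "c = of_real (re c) - j * of_real (re (j * c))" for c
      by (rule inj) (simp add: add diff mult j real re_def complex_eq_iff)
    ultimately show ?thesis using lin le of_real by (intro that[of re j]) auto
  qed
qed

definition re_part :: "'k::real_or_complex \<Rightarrow> real"
  where "re_part = (SOME re. \<exists>j. linear re \<and> (\<forall>c. \<bar>re c\<bar> \<le> norm c) \<and> (\<forall>r. re (of_real r) = r) \<and>
    re j = 0 \<and> (j = 0 \<or> j * j = - 1) \<and>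
    (\<forall>c. c = of_real (re c) - j * of_real (re (j * c))))"

definition imag_unit :: "'k::real_or_complex"
  where "imag_unit = (SOME j. re_part j = 0 \<and> (j = 0 \<or> j * j = - 1) \<and>
    (\<forall>c. c = of_real (re_part c) - j * of_real (re_part (j * c))))"

lemma
  shows linear_re_part: "linear (re_part :: 'k::real_or_complex \<Rightarrow> real)"
    and re_part_le_norm: "\<bar>re_part c\<bar> \<le> norm (c :: 'k)"
    and re_part_of_real [simp]: "re_part (of_real r :: 'k) = r"
    and re_part_imag_unit: "re_part (imag_unit :: 'k) = 0"
    and imag_unit_cases: "(imag_unit :: 'k) = 0 \<or> (imag_unit :: 'k) * imag_unit = - 1"
    and re_part_decomposition: "c = of_real (re_part c) - imag_unit * of_real (re_part (imag_unit * c))"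
proof -
  have ex: "\<exists>re. \<exists>j::'k. linear re \<and> (\<forall>c. \<bar>re c\<bar> \<le> norm c) \<and> (\<forall>r. re (of_real r) = r) \<and>
    re j = 0 \<and> (j = 0 \<or> j * j = - 1) \<and>
    (\<forall>c. c = of_real (re c) - j * of_real (re (j * c)))"
    by (rule real_part_exists) blast
  note re = someI_ex[OF ex, folded re_part_def]
  then have "\<exists>j::'k. re_part j = 0 \<and> (j = 0 \<or> j * j = - 1) \<and>
    (\<forall>c. c = of_real (re_part c) - j * of_real (re_part (j * c)))" by blast
  note j = someI_ex[OF this, folded imag_unit_def]
  show "linear (re_part :: 'k \<Rightarrow> real)" "\<bar>re_part c\<bar> \<le> norm (c :: 'k)"
    "re_part (of_real r :: 'k) = r" using re by blast+
  show "re_part (imag_unit :: 'k) = 0"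
    "(imag_unit :: 'k) = 0 \<or> (imag_unit :: 'k) * imag_unit = - 1"
    "c = of_real (re_part c) - imag_unit * of_real (re_part (imag_unit * c))"
    using j by blast+
qed

lemma re_part_add: "re_part (c + d) = re_part c + re_part d"
  and re_part_0 [simp]: "re_part 0 = 0"
  and re_part_diff: "re_part (c - d) = re_part c - re_part d"
  and re_part_sum: "re_part (\<Sum>i\<in>I. f i) = (\<Sum>i\<in>I. re_part (f i))"
  and re_part_scaleR: "re_part (r *\<^sub>R c) = r * re_part c"
  using linear_add[OF linear_re_part] linear_0[OF linear_re_part] linear_diff[OF linear_re_part]
    linear_sum[OF linear_re_part] linear_scale[OF linear_re_part] by simp_all

lemma re_part_mult_of_real [simp]: "re_part (c * of_real r) = r * re_part c"
  using re_part_scaleR[of r c] by (simp add: scaleR_conv_of_real mult.commute)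

lemma rotate_to_norm:
  fixes c :: "'k::real_or_complex"
  obtains u :: 'k where "norm u = 1" "u * c = of_real (norm c)"
proof (cases "c = 0")
  case True
  then show ?thesis using that[of 1] by simp
next
  case False
  then show ?thesis using that[of "of_real (norm c) / c"] by (simp add: norm_divide)
qed

lemma eq_0_if_re_part_multiples:
  fixes w :: "'k::real_or_complex"
  assumes "\<And>c. re_part (c * w) = 0"
  shows "w = 0"
proof -
  obtain u :: 'k where "u * w = of_real (norm w)" by (rule rotate_to_norm)
  then show ?thesis using assms[of u] by simp
qed

section \<open>Functionals\<close>

lemma norm_blinfun_leI:
  fixes h :: "'a::real_normed_vector \<Rightarrow>\<^sub>L 'b::real_normed_vector"
  assumes "0 \<le> C" "\<And>x. norm (blinfun_apply h x) \<le> C * norm x"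
  shows "norm h \<le> C"
  by (rule norm_blinfun_bound) (use assms in auto)

context banach_space_over
begin

lemma dual_space_add: "g \<in> dual_space scale \<Longrightarrow> h \<in> dual_space scale \<Longrightarrow> g + h \<in> dual_space scale"
  and dual_space_scale: "g \<in> dual_space scale \<Longrightarrow> dual_scale c g \<in> dual_space scale"
  and dual_space_0: "0 \<in> dual_space scale"
  by (auto simp: dual_space_def blinfun.add_left dual_scale_apply algebra_simps)

lemma apply_scale: "g \<in> dual_space scale \<Longrightarrow> blinfun_apply g (scale c x) = c * blinfun_apply g x"
  by (simp add: dual_space_def)

lemma norm_dual_scale: "norm (dual_scale c (h :: 'a \<Rightarrow>\<^sub>L 'k)) = norm c * norm h"
proof -
  have le: "norm (dual_scale c h) \<le> norm c * norm h" for c and h :: "'a \<Rightarrow>\<^sub>L 'k"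
    by (rule norm_blinfun_leI)
      (auto simp: dual_scale_apply norm_mult norm_blinfun mult.assoc intro!: mult_left_mono)
  show ?thesis
  proof (cases "c = 0")
    case True
    then show ?thesis using le[of c h] by simp
  next
    case False
    have "dual_scale (inverse c) (dual_scale c h) = h"
      by (rule blinfun_eqI) (simp add: dual_scale_apply False)
    then have "norm h \<le> inverse (norm c) * norm (dual_scale c h)"
      using le[of "inverse c" "dual_scale c h"] by (simp add: norm_inverse)
    then have "norm c * norm h \<le> norm (dual_scale c h)" using False by (simp add: field_simps)
    then show ?thesis using le[of c h] by simp
  qed
qed

text \<open>
  The classical formula \<open>h x = F x - j * F (j x)\<close>, with \<open>j = 0\<close> in the real case. The norm does not
  grow, because the value \<open>h x\<close> becomes real after multiplying \<open>x\<close> by a scalar of modulus one.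
\<close>

lemma real_functional_is_real_part:
  fixes F :: "'a \<Rightarrow> real"
  assumes F: "linear F" and bound: "\<And>x. F x \<le> C * norm x" and C: "0 \<le> C"
  obtains h where "h \<in> dual_space scale" "\<And>x. re_part (blinfun_apply h x) = F x" "norm h \<le> C"
proof -
  define j where "j = (imag_unit :: 'k)"
  define h where "h x = of_real (F x) - j * of_real (F (scale j x))" for x
  note F_add = linear_add[OF F] and F_scale = linear_scale[OF F]
  have add: "h (x + y) = h x + h y" for x y
    by (simp add: h_def F_add scale_right_distrib algebra_simps)
  have real: "h (scale (of_real r) x) = of_real r * h x" for r x
  proof -
    have "scale j (scale (of_real r) x) = r *\<^sub>R scale j x"
      by (metis scale_of_real scale_scale mult.commute)
    then show ?thesis by (simp add: h_def scale_of_real F_scale algebra_simps)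
  qed
  have j: "h (scale j x) = j * h x" for x
  proof (cases "j = 0")
    case True
    then show ?thesis by (simp add: h_def linear_0[OF F])
  next
    case False
    then have jj: "j * j = - 1" using imag_unit_cases by (auto simp: j_def)
    then have "F (scale j (scale j x)) = - F x"
      using linear_neg[OF F, of x] by simp
    then have "h (scale j x) = of_real (F (scale j x)) + j * of_real (F x)"
      by (simp add: h_def)
    also have "\<dots> = j * of_real (F x) - (j * j) * of_real (F (scale j x))" by (simp add: jj)
    also have "\<dots> = j * h x" by (simp add: h_def algebra_simps)
    finally show ?thesis .
  qed
  have scale: "h (scale c x) = c * h x" for c x
  proof -
    define a b where "a = re_part c" and "b = - re_part (j * c)"
    have c: "c = of_real a + of_real b * j"
      unfolding a_def b_def using re_part_decomposition[of c] by (simp add: j_def algebra_simps)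
    have "h (scale c x) = h (scale (of_real a) x + scale (of_real b) (scale j x))"
      by (simp add: c scale_left_distrib)
    also have "\<dots> = c * h x" by (simp only: add real j) (simp add: c algebra_simps)
    finally show ?thesis .
  qed
  have re: "re_part (h x) = F x" for x
    by (simp add: h_def re_part_diff j_def re_part_imag_unit)
  have norm: "norm (h x) \<le> C * norm x" for x
  proof -
    obtain u :: 'k where u: "norm u = 1" "u * h x = of_real (norm (h x))" by (rule rotate_to_norm)
    have "norm (h x) = re_part (h (scale u x))" by (simp add: scale u)
    also have "\<dots> \<le> C * norm x" using bound[of "scale u x"] by (simp add: re norm_scale u)
    finally show ?thesis .
  qed
  have "bounded_linear h"
    by (rule bounded_linear_intro[where K = C])
      (use add scale norm in \<open>simp_all add: scale_of_real[symmetric] scaleR_conv_of_real mult.commute\<close>)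
  then have "blinfun_apply (Blinfun h) = h" by (rule bounded_linear_Blinfun_apply)
  then show ?thesis
    by (intro that[of "Blinfun h"]) (use scale re norm C in \<open>auto simp: dual_space_def intro: norm_blinfun_leI\<close>)
qed

lemma norming_functional:
  obtains h where "h \<in> dual_space scale" "norm h \<le> 1" "re_part (blinfun_apply h x) = norm x"
proof -
  obtain F where F: "linear F" "\<And>y. F y \<le> norm y" "F x = norm x"
    using Hahn_Banach_sublinear[OF sublinear_norm] by blast
  obtain h where "h \<in> dual_space scale" "\<And>y. re_part (blinfun_apply h y) = F y" "norm h \<le> 1"
    using real_functional_is_real_part[OF F(1), of 1] F(2) by auto
  then show ?thesis using F(3) that by simp
qed

lemma re_part_blinfun_le:
  fixes h :: "'a \<Rightarrow>\<^sub>L 'k"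
  shows "re_part (blinfun_apply h x) \<le> norm h * norm x"
  using re_part_le_norm[of "blinfun_apply h x"] norm_blinfun[of h x] by linarith

lemma eq_if_functionals_eq:
  assumes "\<And>h. h \<in> dual_space scale \<Longrightarrow> blinfun_apply h x = blinfun_apply h y"
  shows "x = y"
proof -
  obtain h where "h \<in> dual_space scale" "re_part (blinfun_apply h (x - y)) = norm (x - y)"
    using norming_functional by blast
  then show ?thesis using assms by (simp add: blinfun.diff_right)
qed

end

section \<open>Operators with the Daugavet equation\<close>

lemma onorm_nearly_attained:
  assumes f: "bounded_linear f" and c: "c < onorm f"
  obtains x where "norm x \<le> 1" "c < norm (f x)"
proof -
  have "\<exists>x. norm x \<le> 1 \<and> c < norm (f x)"
  proof (rule ccontr)
    assume "\<not> ?thesis"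
    then have le: "norm (f x) \<le> c" if "norm x \<le> 1" for x using that by force
    interpret bounded_linear f by fact
    have c0: "0 \<le> c" using le[of 0] by simp
    have "norm (f x) \<le> c * norm x" for x
    proof (cases "x = 0")
      case False
      have "norm (f (inverse (norm x) *\<^sub>R x)) \<le> c" by (rule le) (use False in simp)
      then show ?thesis using False by (simp add: scaleR field_simps)
    qed (simp add: zero)
    then have "onorm f \<le> c" by (rule onorm_bound[OF c0])
    then show False using c by simp
  qed
  then show ?thesis using that by blast
qed

context banach_space_over
begin

lemma bounded_operator_bounded_linear:
  assumes "bounded_operator scale UNIV UNIV T"
  shows "bounded_linear T"
proof -
  obtain B where "\<And>x. norm (T x) \<le> B * norm x"
    using assms by (auto simp: bounded_operator_def)
  then show ?thesis
    using assms
    by (intro bounded_linear_intro[where K = B])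
      (auto simp: bounded_operator_def mult.commute simp flip: scale_of_real)
qed

lemma bounded_operator_iff:
  "bounded_operator scale UNIV UNIV T \<longleftrightarrow> bounded_linear T \<and> (\<forall>c x. T (scale c x) = scale c (T x))"
proof
  assume "bounded_operator scale UNIV UNIV T"
  then show "bounded_linear T \<and> (\<forall>c x. T (scale c x) = scale c (T x))"
    using bounded_operator_bounded_linear by (simp add: bounded_operator_def)
next
  assume T: "bounded_linear T \<and> (\<forall>c x. T (scale c x) = scale c (T x))"
  then obtain B where "\<forall>x. norm (T x) \<le> norm x * B" using bounded_linear.bounded by blast
  then show "bounded_operator scale UNIV UNIV T"
    using T by (auto simp: bounded_operator_def bounded_linear.linear linear_add mult.commute)
qed

lemma bounded_linear_scale_left: "bounded_linear (\<lambda>c. scale c x)"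
  by (rule bounded_linear_intro[where K = "norm x"])
    (simp_all add: scale_left_distrib norm_scale scaleR_conv_of_real flip: scale_of_real)

lemma bounded_operator_rank_one:
  assumes "h \<in> dual_space scale"
  shows "bounded_operator scale UNIV UNIV (\<lambda>x. scale (blinfun_apply h x) y)"
  unfolding bounded_operator_iff
  using assms
  by (auto intro!: bounded_linear_compose[OF bounded_linear_scale_left] blinfun.bounded_linear_right
      simp: apply_scale)

lemma dim_range_rank_one:
  assumes h: "h \<in> dual_space scale" and "h \<noteq> 0" "y \<noteq> 0"
  shows "dim (range (\<lambda>x. scale (blinfun_apply h x) y)) = 1"
proof (rule dim_unique)
  obtain x where "blinfun_apply h x \<noteq> 0" using \<open>h \<noteq> 0\<close> by (metis blinfun_eqI zero_blinfun.rep_eq)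
  then have "y = scale (blinfun_apply h (scale (inverse (blinfun_apply h x)) x)) y"
    by (simp add: apply_scale[OF h])
  then show "{y} \<subseteq> range (\<lambda>x. scale (blinfun_apply h x) y)" by blast
  show "range (\<lambda>x. scale (blinfun_apply h x) y) \<subseteq> span {y}"
    by (auto intro: span_scale span_base)
  show "independent {y}" using \<open>y \<noteq> 0\<close> by (simp add: dependent_single)
qed simp

text \<open>
  The form in which the hypothesis is used; the operators of rank one are those of the form
  \<open>x \<mapsto> h(x) y\<close>.
\<close>

lemma Daugavet_rank_one:
  assumes D: "daugavet_property scale" and h: "h \<in> dual_space scale" "norm h = 1"
    and y: "norm y = 1" and c: "c < 2"
  obtains x where "norm x \<le> 1" "c < norm (x + scale (blinfun_apply h x) y)"
proof -
  define T where "T x = scale (blinfun_apply h x) y" for x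
  have T: "bounded_operator scale UNIV UNIV T"
    unfolding T_def by (rule bounded_operator_rank_one[OF h(1)])
  then have lin: "bounded_linear T" by (rule bounded_operator_bounded_linear)
  have "dim (range T) = 1"
    unfolding T_def by (rule dim_range_rank_one[OF h(1)]) (use h(2) y in auto)
  then have eq: "onorm (\<lambda>x. x + T x) = 1 + onorm T"
    using D T by (simp add: daugavet_property_def)
  have "norm h \<le> onorm T"
  proof (rule norm_blinfun_leI)
    show "norm (blinfun_apply h x) \<le> onorm T * norm x" for x
      using onorm[OF lin, of x] by (simp add: T_def norm_scale y)
  qed (rule onorm_pos_le[OF lin])
  then have "c < onorm (\<lambda>x. x + T x)" using eq h(2) c by simp
  moreover have "bounded_linear (\<lambda>x. x + T x)" by (intro bounded_linear_add bounded_linear_ident lin)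
  ultimately obtain x where "norm x \<le> 1" "c < norm (x + T x)"
    using onorm_nearly_attained by blast
  then show ?thesis using that by (simp add: T_def)
qed

text \<open>
  The key geometric step. A slice of the unit ball is a set \<open>{z. norm z \<le> 1 \<and> 1 - d < Re (h z)}\<close> with
  \<open>norm h = 1\<close>. The Daugavet equation for \<open>x \<mapsto> h(x) y\<close> gives a point \<open>x\<close> of the ball and a functional
  \<open>k\<close> of norm at most one with \<open>Re (k x + h x * k y)\<close> close to \<open>2\<close>. Hence, up to a rotation \<open>u\<close> of \<open>k\<close>, the functional
  \<open>u k + \<bar>k y\<bar> h\<close> almost attains the largest possible norm \<open>2\<close>. Wherever it is nearly \<open>2\<close>, each of
  its two terms must be nearly \<open>1\<close>: the second term puts \<open>z\<close> into the slice of \<open>h\<close> and makes \<open>\<bar>k y\<bar>\<close>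
  nearly \<open>1\<close>, and with the first term this makes \<open>u k\<close> nearly \<open>2\<close> at \<open>z + y\<close>.
\<close>

lemma subslice_far_from_unit_vector:
  assumes D: "daugavet_property scale" and h: "h \<in> dual_space scale" "norm h = 1"
    and y: "norm y = 1" and d: "0 < d"
  obtains h' d' where "h' \<in> dual_space scale" "norm h' = 1" "0 < d'"
    "\<And>z. norm z \<le> 1 \<Longrightarrow> 1 - d' < re_part (blinfun_apply h' z) \<Longrightarrow>
      1 - d < re_part (blinfun_apply h z) \<and> 2 - d < norm (z + y)"
proof -
  \<comment> \<open>The errors below add up to \<open>6 * e\<close>, and \<open>6 * e \<le> 1\<close> keeps \<open>Re (h z)\<close> positive.\<close>
  define e where "e = min d 1 / 6"
  have e: "0 < e" "6 * e \<le> d" "6 * e \<le> 1" using d by (auto simp: e_def)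
  obtain x where x: "norm x \<le> 1" "2 - e < norm (x + scale (blinfun_apply h x) y)"
    using Daugavet_rank_one[OF D h y, of "2 - e"] e by auto
  obtain k where k: "k \<in> dual_space scale" "norm k \<le> 1"
    "re_part (blinfun_apply k (x + scale (blinfun_apply h x) y)) = norm (x + scale (blinfun_apply h x) y)"
    using norming_functional by blast
  have k_le: "norm (blinfun_apply k v) \<le> norm v" for v
    using norm_blinfun[of k v] mult_right_mono[OF k(2), of "norm v"] by simp
  obtain u :: 'k where u: "norm u = 1" "u * blinfun_apply k y = of_real (norm (blinfun_apply k y))"
    by (rule rotate_to_norm)
  define r where "r = norm (blinfun_apply k y)"
  have r: "0 \<le> r" "r \<le> 1" using k_le[of y] y by (auto simp: r_def)
  define g where "g = dual_scale u k + dual_scale (of_real r) h"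
  have g: "g \<in> dual_space scale"
    unfolding g_def by (intro dual_space_add dual_space_scale k h)
  have g_apply: "blinfun_apply g z = u * blinfun_apply k z + of_real r * blinfun_apply h z" for z
    by (simp add: g_def blinfun.add_left dual_scale_apply)
  have "blinfun_apply g x = u * blinfun_apply k (x + scale (blinfun_apply h x) y)"
    using u(2) by (simp add: g_apply blinfun.add_right apply_scale[OF k(1)] r_def algebra_simps)
  then have "norm (blinfun_apply g x) = norm (blinfun_apply k (x + scale (blinfun_apply h x) y))"
    by (simp add: norm_mult u(1))
  then have "2 - e < norm (blinfun_apply g x)"
    using k(3) re_part_le_norm[of "blinfun_apply k (x + scale (blinfun_apply h x) y)"] x(2) by linarith
  also have "\<dots> \<le> norm g" using norm_blinfun[of g x] x(1) mult_left_mono[of "norm x" 1 "norm g"] by simp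
  finally have G: "2 - e < norm g" .
  then have "g \<noteq> 0" using e by auto
  define h' where "h' = dual_scale (of_real (1 / norm g)) g"
  have "h' \<in> dual_space scale" unfolding h'_def by (rule dual_space_scale[OF g])
  moreover have "norm h' = 1" using \<open>g \<noteq> 0\<close> unfolding h'_def norm_dual_scale by (simp add: norm_divide)
  moreover have "1 - d < re_part (blinfun_apply h z) \<and> 2 - d < norm (z + y)"
    if z: "norm z \<le> 1" "1 - e < re_part (blinfun_apply h' z)" for z
  proof -
    have G0: "0 < norm g" using G e by linarith
    have "re_part (blinfun_apply h' z) = re_part (blinfun_apply g z) / norm g"
      unfolding h'_def dual_scale_apply by (metis re_part_mult_of_real mult.commute times_divide_eq_left mult_1)
    then have "(1 - e) * norm g < re_part (blinfun_apply g z)"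
      using z(2) G0 by (simp add: field_simps)
    moreover have "(1 - e) * (2 - e) \<le> (1 - e) * norm g"
      by (rule mult_left_mono) (use G e in auto)
    moreover have "2 - 3 * e \<le> (1 - e) * (2 - e)" by (simp add: algebra_simps)
    ultimately have gz: "2 - 3 * e < re_part (blinfun_apply g z)" by linarith
    define a b where "a = re_part (u * blinfun_apply k z)" and "b = re_part (blinfun_apply h z)"
    have ab: "re_part (blinfun_apply g z) = a + r * b"
      unfolding g_apply re_part_add a_def b_def by (simp add: mult.commute[of "of_real r"])
    have a1: "a \<le> 1"
      using re_part_le_norm[of "u * blinfun_apply k z"] k_le[of z] z(1) by (simp add: a_def norm_mult u(1))
    have b1: "b \<le> 1"
      using re_part_blinfun_le[of h z] z(1) by (simp add: b_def h(2))
    have rb: "r * b \<le> r" using mult_left_mono[OF b1 r(1)] by simp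
    have rb': "1 - 3 * e < r * b" using gz ab a1 by linarith
    then have "0 < r * b" using e by linarith
    then have "0 < b" using r(1) by (simp add: zero_less_mult_iff)
    then have "r * b \<le> b" using r(2) mult_right_mono[of r 1 b] by simp
    then have "1 - d < b" using rb' e by linarith
    moreover have "2 - d < norm (z + y)"
    proof -
      have "a + r = re_part (u * blinfun_apply k (z + y))"
        using u(2) by (simp add: a_def r_def blinfun.add_right distrib_left re_part_add)
      also have "\<dots> \<le> norm (z + y)"
        using re_part_le_norm[of "u * blinfun_apply k (z + y)"] k_le[of "z + y"]
        by (simp add: norm_mult u(1))
      finally show ?thesis using gz ab rb rb' r a1 e by linarith
    qed
    ultimately show ?thesis by (simp add: b_def)
  qed
  ultimately show ?thesis using that e(1) by blast
qed

text \<open>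
  Scaling \<open>y\<close> to a unit vector \<open>v\<close> is harmless: if \<open>norm (z + v)\<close> is nearly \<open>2\<close>, then the
  norm is nearly additive on the whole cone that \<open>z\<close> and \<open>v\<close> span.
\<close>

lemma subslice_far_from_vector:
  assumes D: "daugavet_property scale" and h: "h \<in> dual_space scale" "norm h = 1" and d: "0 < d"
  shows "\<exists>h' d'. h' \<in> dual_space scale \<and> norm h' = 1 \<and> 0 < d' \<and>
    (\<forall>z. norm z \<le> 1 \<longrightarrow> 1 - d' < re_part (blinfun_apply h' z) \<longrightarrow>
      1 - d < re_part (blinfun_apply h z) \<and> 1 + norm y - d < norm (z + y))"
proof (cases "y = 0")
  case True
  have "1 - d < norm z" if "1 - d < re_part (blinfun_apply h z)" for z
    using that re_part_blinfun_le[of h z] by (simp add: h(2))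
  then show ?thesis using True h d by (intro exI[of _ h] exI[of _ d]) auto
next
  case False
  define r where "r = norm y"
  define v where "v = y /\<^sub>R r"
  have r: "0 < r" and v: "norm v = 1" and y: "y = r *\<^sub>R v" using False by (auto simp: r_def v_def)
  define e where "e = d / (1 + r)"
  have e: "0 < e" "e \<le> d" "r * e \<le> d"
    using r d by (auto simp: e_def field_simps)
  obtain h' d' where h': "h' \<in> dual_space scale" "norm h' = 1" "0 < d'"
    "\<And>z. norm z \<le> 1 \<Longrightarrow> 1 - d' < re_part (blinfun_apply h' z) \<Longrightarrow>
      1 - e < re_part (blinfun_apply h z) \<and> 2 - e < norm (z + v)"
    using subslice_far_from_unit_vector[OF D h v e(1)] by blast
  have "1 + r - d < norm (z + y)" if z: "norm z \<le> 1" "2 - e < norm (z + v)" for z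
  proof (cases "r \<le> 1")
    case True
    have eq: "z + v = (z + y) + (1 - r) *\<^sub>R v" by (simp add: y algebra_simps)
    have "norm (z + v) \<le> norm (z + y) + norm ((1 - r) *\<^sub>R v)"
      unfolding eq by (rule norm_triangle_ineq)
    then have "norm (z + v) \<le> norm (z + y) + (1 - r)" using True v by simp
    then show ?thesis using z e by linarith
  next
    case False
    have "r *\<^sub>R (z + v) = (z + y) + (r - 1) *\<^sub>R z" by (simp add: y algebra_simps)
    then have "r * norm (z + v) \<le> norm (z + y) + (r - 1) * norm z"
      using norm_triangle_ineq[of "z + y" "(r - 1) *\<^sub>R z"] False r by (metis abs_of_pos abs_of_nonneg diff_ge_0_iff_ge linorder_linear norm_scaleR)
    moreover have "(r - 1) * norm z \<le> r - 1" using z(1) False mult_left_mono[of "norm z" 1 "r - 1"] by simp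
    moreover have "r * (2 - e) < r * norm (z + v)" using z(2) r by simp
    moreover have "r * (2 - e) = 2 * r - r * e" by (simp add: algebra_simps)
    ultimately show ?thesis using e by linarith
  qed
  then show ?thesis using h' e by (intro exI[of _ h'] exI[of _ d']) (fastforce simp: r_def)
qed

text \<open>
  A slice may be shrunk repeatedly, once for each vector in \<open>K\<close>. This is what leads from operators
  of rank one to compact ones.
\<close>

lemma subslice_far_from_finite_set:
  assumes D: "daugavet_property scale" and h: "h \<in> dual_space scale" "norm h = 1" and d: "0 < d"
    and K: "finite K"
  shows "\<exists>h' d'. h' \<in> dual_space scale \<and> norm h' = 1 \<and> 0 < d' \<and>
    (\<forall>z. norm z \<le> 1 \<longrightarrow> 1 - d' < re_part (blinfun_apply h' z) \<longrightarrow>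
      1 - d < re_part (blinfun_apply h z) \<and> (\<forall>y\<in>K. 1 + norm y - d < norm (z + y)))"
  using K
proof induction
  case empty
  then show ?case using h d by blast
next
  case (insert y K)
  then obtain h1 d1 where h1: "h1 \<in> dual_space scale" "norm h1 = 1" "0 < d1"
    "\<And>z. norm z \<le> 1 \<Longrightarrow> 1 - d1 < re_part (blinfun_apply h1 z) \<Longrightarrow>
      1 - d < re_part (blinfun_apply h z) \<and> (\<forall>y\<in>K. 1 + norm y - d < norm (z + y))"
    by blast
  have "0 < min d d1" using h1 d by simp
  from subslice_far_from_vector[OF D h1(1,2) this, of y]
  obtain h2 d2 where h2: "h2 \<in> dual_space scale" "norm h2 = 1" "0 < d2"
    "\<And>z. norm z \<le> 1 \<Longrightarrow> 1 - d2 < re_part (blinfun_apply h2 z) \<Longrightarrow>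
      1 - min d d1 < re_part (blinfun_apply h1 z) \<and> 1 + norm y - min d d1 < norm (z + y)"
    by blast
  have "1 - d < re_part (blinfun_apply h z) \<and> (\<forall>y\<in>insert y K. 1 + norm y - d < norm (z + y))"
    if z: "norm z \<le> 1" "1 - d2 < re_part (blinfun_apply h2 z)" for z
  proof -
    have "1 - d1 < re_part (blinfun_apply h1 z)" "1 + norm y - d < norm (z + y)"
      using h2(4)[OF z] by linarith+
    then show ?thesis using h1(4)[OF z(1)] by blast
  qed
  then show ?case using h2(1-3) by blast
qed

lemma slice_nonempty:
  fixes h :: "'a \<Rightarrow>\<^sub>L 'k"
  assumes h: "h \<in> dual_space scale" and c: "c < norm h"
  obtains z where "norm z \<le> 1" "c < re_part (blinfun_apply h z)"
proof -
  obtain x where x: "norm x \<le> 1" "c < norm (blinfun_apply h x)"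
    using onorm_nearly_attained[OF blinfun.bounded_linear_right, of c h] c by (auto simp: norm_blinfun.rep_eq)
  obtain u :: 'k where u: "norm u = 1" "u * blinfun_apply h x = of_real (norm (blinfun_apply h x))"
    by (rule rotate_to_norm)
  show ?thesis
    by (rule that[of "scale u x"]) (use x u in \<open>simp_all add: norm_scale apply_scale[OF h]\<close>)
qed

text \<open>
  Choose a slice on which \<open>norm (T z)\<close> is almost maximal, and shrink it until its points \<open>z\<close> are
  far from a finite net \<open>K\<close> of the image of the unit ball, in the sense that \<open>norm (z + y)\<close> is almost
  \<open>1 + norm y\<close> for all \<open>y\<close> in \<open>K\<close>. For such a \<open>z\<close>, some \<open>y\<close> in the net is close to \<open>T z\<close>.
\<close>

theorem Daugavet_compact_operator:
  assumes D: "daugavet_property scale" and nontrivial: "\<exists>x::'a. x \<noteq> 0"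
    and T: "bounded_operator scale UNIV UNIV T"
    and compact: "\<And>e. 0 < e \<Longrightarrow> \<exists>K. finite K \<and> (\<forall>x. norm x \<le> 1 \<longrightarrow> (\<exists>y\<in>K. norm (T x - y) \<le> e))"
  shows "onorm (\<lambda>x. x + T x) = 1 + onorm T"
proof (rule antisym)
  have lin: "bounded_linear T" by (rule bounded_operator_bounded_linear[OF T])
  have lin': "bounded_linear (\<lambda>x. x + T x)" by (intro bounded_linear_add bounded_linear_ident lin)
  have T_scale: "T (scale c x) = scale c (T x)" for c x using T by (simp add: bounded_operator_def)
  obtain x0 :: 'a where "x0 \<noteq> 0" using nontrivial by blast
  define N where "N = onorm T"
  have N0: "0 \<le> N" unfolding N_def by (rule onorm_pos_le[OF lin])
  show "onorm (\<lambda>x. x + T x) \<le> 1 + onorm T"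
    using onorm_triangle[OF bounded_linear_ident lin] onorm_id_le[where 'a = 'a] by (simp add: id_def)
  show "1 + onorm T \<le> onorm (\<lambda>x. x + T x)"
  proof (cases "N = 0")
    case True
    then have T0: "T x = 0" for x using onorm[OF lin, of x] by (simp add: N_def)
    have "norm x0 \<le> onorm (\<lambda>x. x + T x) * norm x0" using onorm[OF lin', of x0] T0 by simp
    then have "1 \<le> onorm (\<lambda>x. x + T x)" using \<open>x0 \<noteq> 0\<close> by simp
    then show ?thesis using True by (simp add: N_def)
  next
    case False
    then have N: "0 < N" using N0 by simp
    have approx: "1 + N \<le> onorm (\<lambda>x. x + T x) + (4 + N) * e" if e: "0 < e" for e
    proof -
      obtain x where x: "norm x \<le> 1" "N - min e N < norm (T x)"
        using onorm_nearly_attained[OF lin, of "N - min e N"] e N by (auto simp: N_def)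
      obtain k where k: "k \<in> dual_space scale" "norm k \<le> 1" "re_part (blinfun_apply k (T x)) = norm (T x)"
        using norming_functional by blast
      define g where "g = k o\<^sub>L Blinfun T"
      have g_apply: "blinfun_apply g z = blinfun_apply k (T z)" for z
        by (simp add: g_def bounded_linear_Blinfun_apply[OF lin])
      have g: "g \<in> dual_space scale"
        by (simp add: dual_space_def g_apply T_scale apply_scale[OF k(1)])
      have G: "N - min e N < norm g"
        using re_part_blinfun_le[of g x] x mult_left_mono[OF x(1), of "norm g"] by (simp add: g_apply k(3))
      have G0: "0 < norm g" using G by (smt (verit))
      have "norm (blinfun_apply k v) \<le> norm v" for v
        using norm_blinfun[of k v] mult_right_mono[OF k(2), of "norm v"] by simp
      then have re_k: "re_part (blinfun_apply k v) \<le> norm v" for v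
        using re_part_le_norm[of "blinfun_apply k v"] by (smt (verit))
      have GN: "norm g \<le> N"
      proof (rule norm_blinfun_leI[OF N0])
        show "norm (blinfun_apply g z) \<le> N * norm z" for z
          unfolding g_apply using \<open>norm (blinfun_apply k (T z)) \<le> norm (T z)\<close> onorm[OF lin, of z]
          by (simp add: N_def)
      qed
      define h where "h = dual_scale (of_real (1 / norm g)) g"
      have h: "h \<in> dual_space scale" unfolding h_def by (rule dual_space_scale[OF g])
      have h1: "norm h = 1" using G0 unfolding h_def norm_dual_scale by (simp add: norm_divide)
      have re_h: "re_part (blinfun_apply h z) = re_part (blinfun_apply g z) / norm g" for z
        unfolding h_def dual_scale_apply by (metis re_part_mult_of_real mult.commute times_divide_eq_left mult_1)
      obtain K where K: "finite K" "\<And>z. norm z \<le> 1 \<Longrightarrow> \<exists>y\<in>K. norm (T z - y) \<le> e"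
        using compact[OF e] by blast
      obtain h' d' where h': "h' \<in> dual_space scale" "norm h' = 1" "0 < d'"
        "\<And>z. norm z \<le> 1 \<Longrightarrow> 1 - d' < re_part (blinfun_apply h' z) \<Longrightarrow>
          1 - e < re_part (blinfun_apply h z) \<and> (\<forall>y\<in>K. 1 + norm y - e < norm (z + y))"
        using subslice_far_from_finite_set[OF D h h1 e K(1)] by blast
      obtain z where z: "norm z \<le> 1" "1 - d' < re_part (blinfun_apply h' z)"
        using slice_nonempty[OF h'(1), of "1 - d'"] h'(2,3) by auto
      obtain y where y: "y \<in> K" "norm (T z - y) \<le> e" using K(2)[OF z(1)] by blast
      have 1: "1 - e < re_part (blinfun_apply h z)" and 2: "1 + norm y - e < norm (z + y)"
        using h'(4)[OF z] y(1) by auto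
      have "(1 - e) * norm g < re_part (blinfun_apply g z)"
        using 1 G0 by (simp add: re_h field_simps)
      also have "\<dots> \<le> norm (T z)" unfolding g_apply by (rule re_k)
      finally have "norm g - e * norm g < norm (T z)" by (simp add: algebra_simps)
      moreover have "e * norm g \<le> e * N" using GN e by simp
      ultimately have Tz: "N - e - e * N < norm (T z)" using G by linarith
      have "norm (T z) \<le> norm y + e" using y(2) norm_triangle_sub[of "T z" y] by linarith
      moreover have "norm (z + y) \<le> norm (z + T z) + e"
        using y(2) norm_triangle_ineq[of "z + T z" "y - T z"] by (simp add: norm_minus_commute)
      moreover have "norm (z + T z) \<le> onorm (\<lambda>x. x + T x)"
        using onorm[OF lin', of z] mult_left_mono[OF z(1) onorm_pos_le[OF lin']] by simp
      ultimately show ?thesis using Tz 2 by (simp add: algebra_simps)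
    qed
    have "1 + N \<le> onorm (\<lambda>x. x + T x) + d" if "0 < d" for d
      using approx[of "d / (4 + N)"] that N by simp
    then show ?thesis unfolding N_def by (rule field_le_epsilon)
  qed
qed

end

section \<open>Finite intersections of kernels\<close>

lemma onorm_on_leI:
  assumes "F \<noteq> {}" "0 \<le> C" "\<And>x. x \<in> F \<Longrightarrow> norm (T x) \<le> C * norm x"
  shows "onorm_on F T \<le> C"
  unfolding onorm_on_def
proof (rule cSUP_least[OF assms(1)])
  fix x assume "x \<in> F"
  then show "norm (T x) / norm x \<le> C"
    using assms(2) assms(3)[of x] by (cases "x = 0") (auto simp: field_simps)
qed

lemma bdd_above_onorm_on:
  assumes "bounded_operator s F E T"
  shows "bdd_above ((\<lambda>x. norm (T x) / norm x) ` F)"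
proof -
  obtain B where B: "\<forall>x\<in>F. norm (T x) \<le> B * norm x"
    using assms by (auto simp: bounded_operator_def)
  show ?thesis
  proof (rule bdd_aboveI2[where M = "max B 0"])
    fix x assume "x \<in> F"
    then have "norm (T x) \<le> max B 0 * norm x"
      using B mult_right_mono[of B "max B 0" "norm x"] by (meson max.cobounded1 norm_ge_zero order_trans)
    then show "norm (T x) / norm x \<le> max B 0" by (cases "x = 0") (auto simp: field_simps)
  qed
qed

lemma norm_le_onorm_on:
  assumes T: "bounded_operator s F E T" and x: "x \<in> F"
  shows "norm (T x) \<le> onorm_on F T * norm x"
proof (cases "x = 0")
  case True
  then show ?thesis using T x by (force simp: bounded_operator_def)
next
  case False
  have "norm (T x) / norm x \<le> onorm_on F T"
    unfolding onorm_on_def by (rule cSUP_upper[OF x bdd_above_onorm_on[OF T]])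
  then show ?thesis using False by (simp add: field_simps)
qed

lemma onorm_on_nonneg:
  fixes T :: "'b::real_normed_vector \<Rightarrow> 'b"
  assumes T: "bounded_operator s F E T" and "0 \<in> F"
  shows "0 \<le> onorm_on F T"
proof -
  have "norm (T 0) / norm (0::'b) \<le> onorm_on F T"
    unfolding onorm_on_def by (rule cSUP_upper[OF assms(2) bdd_above_onorm_on[OF T]])
  then show ?thesis by simp
qed

interpretation dual: vector_space
  "dual_scale :: 'k::real_or_complex \<Rightarrow> ('a::banach \<Rightarrow>\<^sub>L 'k) \<Rightarrow> ('a \<Rightarrow>\<^sub>L 'k)"
  by (rule vector_space_dual_scale)

text \<open>
  The values of finitely many functionals on the unit ball form a bounded subset of a
  finite-dimensional space. Rounding the values to a grid sorts the points of the ball into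
  finitely many classes, and one representative of each class suffices.
\<close>

lemma finite_net_for_functionals:
  fixes G :: "('a::real_normed_vector \<Rightarrow>\<^sub>L 'k::real_or_complex) set"
  assumes G: "finite G" and d: "0 < d"
  obtains U where "finite U" "\<And>u. u \<in> U \<Longrightarrow> norm u \<le> 1"
    "\<And>x. norm x \<le> 1 \<Longrightarrow> \<exists>u\<in>U. \<forall>g\<in>G. norm (blinfun_apply g (x - u)) \<le> d"
proof -
  obtain \<phi> :: "'k \<Rightarrow> complex" where add: "\<And>x y. \<phi> (x + y) = \<phi> x + \<phi> y"
    and norm: "\<And>x. cmod (\<phi> x) = norm x"
    using real_or_complex_embedding by blast
  have diff: "\<phi> (x - y) = \<phi> x - \<phi> y" for x y using add[of "x - y" y] by simp
  define e where "e = d / 2"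
  have e: "0 < e" using d by (simp add: e_def)
  define key :: "'a \<Rightarrow> ('a \<Rightarrow>\<^sub>L 'k) \<Rightarrow> int \<times> int" where
    "key x = restrict (\<lambda>g. (\<lfloor>Re (\<phi> (blinfun_apply g x)) / e\<rfloor>, \<lfloor>Im (\<phi> (blinfun_apply g x)) / e\<rfloor>)) G" for x
  obtain M where M: "\<And>g. g \<in> G \<Longrightarrow> norm g \<le> M"
    using finite_imp_bounded[OF G] by (auto simp: bounded_iff)
  define B where "B = {\<lfloor>- M / e\<rfloor>..\<lfloor>M / e\<rfloor>}"
  have in_B: "\<lfloor>t / e\<rfloor> \<in> B" if "\<bar>t\<bar> \<le> M" for t
  proof -
    have "- M / e \<le> t / e" "t / e \<le> M / e" using that e by (intro divide_right_mono; simp)+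
    then show ?thesis unfolding B_def using floor_mono by auto
  qed
  have "key x \<in> PiE G (\<lambda>_. B \<times> B)" if x: "norm x \<le> 1" for x
  proof -
    have "\<lfloor>Re (\<phi> (blinfun_apply g x)) / e\<rfloor> \<in> B \<and> \<lfloor>Im (\<phi> (blinfun_apply g x)) / e\<rfloor> \<in> B" if "g \<in> G" for g
    proof -
      have "norm (blinfun_apply g x) \<le> M"
        using norm_blinfun[of g x] mult_left_mono[OF x, of "norm g"] M[OF that] by simp
      then have "cmod (\<phi> (blinfun_apply g x)) \<le> M" by (simp add: norm)
      then show ?thesis
        using abs_Re_le_cmod abs_Im_le_cmod by (meson in_B order_trans)
    qed
    then show ?thesis by (auto simp: key_def)
  qed
  then have "key ` {x. norm x \<le> 1} \<subseteq> PiE G (\<lambda>_. B \<times> B)" by blast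
  moreover have "finite (PiE G (\<lambda>_. B \<times> B))"
    by (intro finite_PiE G finite_cartesian_product) (simp_all add: B_def)
  ultimately have "finite (key ` {x. norm x \<le> 1})" by (rule finite_subset)
  then obtain U where U: "U \<subseteq> {x. norm x \<le> 1}" "finite U" "key ` {x. norm x \<le> 1} = key ` U"
    using finite_subset_image[of "key ` {x. norm x \<le> 1}" key "{x. norm x \<le> 1}"] by auto
  have "\<exists>u\<in>U. \<forall>g\<in>G. norm (blinfun_apply g (x - u)) \<le> d" if "norm x \<le> 1" for x
  proof -
    have "key x \<in> key ` U" using that U(3) by blast
    then obtain u where u: "u \<in> U" "key x = key u" by blast
    have close: "\<bar>s - t\<bar> \<le> e" if "\<lfloor>s / e\<rfloor> = \<lfloor>t / e\<rfloor>" for s t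
    proof -
      have "\<bar>s / e - t / e\<bar> < 1" using that by linarith
      then show ?thesis using e by (simp add: abs_divide flip: diff_divide_distrib)
    qed
    have "norm (blinfun_apply g (x - u)) \<le> d" if "g \<in> G" for g
    proof -
      let ?a = "\<phi> (blinfun_apply g x)" and ?b = "\<phi> (blinfun_apply g u)"
      have "\<lfloor>Re ?a / e\<rfloor> = \<lfloor>Re ?b / e\<rfloor>" "\<lfloor>Im ?a / e\<rfloor> = \<lfloor>Im ?b / e\<rfloor>"
        using fun_cong[OF u(2), of g] that by (auto simp: key_def)
      then have "\<bar>Re (?a - ?b)\<bar> \<le> e" "\<bar>Im (?a - ?b)\<bar> \<le> e" using close by auto
      then have "cmod (?a - ?b) \<le> d" using cmod_le[of "?a - ?b"] by (simp add: e_def)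
      moreover have "norm (blinfun_apply g (x - u)) = cmod (?a - ?b)"
        by (simp add: blinfun.diff_right diff flip: norm)
      ultimately show ?thesis by simp
    qed
    then show ?thesis using u(1) by blast
  qed
  then show ?thesis using U that by blast
qed

locale common_kernel = banach_space_over scale
  for scale :: "'k::real_or_complex \<Rightarrow> 'a::banach \<Rightarrow> 'a" +
  fixes A :: "('a \<Rightarrow>\<^sub>L 'k) set" and Y :: "'a set" and W :: "('a \<Rightarrow>\<^sub>L 'k) set"
  assumes finite_A: "finite A" and A_dual: "A \<subseteq> dual_space scale"
    and Y_eq: "Y = {x. \<forall>a\<in>A. blinfun_apply a x = 0}"
    and W_eq: "W = dual.span A"
begin

lemma Y_0: "0 \<in> Y"
  and Y_add: "x \<in> Y \<Longrightarrow> y \<in> Y \<Longrightarrow> x + y \<in> Y"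
  and Y_scale: "x \<in> Y \<Longrightarrow> scale c x \<in> Y"
  using A_dual by (auto simp: Y_eq blinfun.add_right apply_scale subset_iff)

lemma Y_scaleR: "x \<in> Y \<Longrightarrow> r *\<^sub>R x \<in> Y"
  using Y_scale[of x "of_real r"] by (simp add: scale_of_real)

lemma W_dual: "g \<in> W \<Longrightarrow> g \<in> dual_space scale"
  unfolding W_eq
proof (induction rule: dual.span_induct_alt)
  case base
  show ?case by (rule dual_space_0)
next
  case (step c x y)
  then show ?case using A_dual by (intro dual_space_add dual_space_scale) auto
qed

lemma W_apply_Y: "g \<in> W \<Longrightarrow> y \<in> Y \<Longrightarrow> blinfun_apply g y = 0"
  unfolding W_eq
proof (induction rule: dual.span_induct_alt)
  case (step c x z)
  then show ?case by (auto simp: blinfun.add_left dual_scale_apply Y_eq)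
qed simp

lemma dual_space_sum: "(\<And>i. i \<in> I \<Longrightarrow> h i \<in> dual_space scale) \<Longrightarrow> (\<Sum>i\<in>I. h i) \<in> dual_space scale"
  by (induction I rule: infinite_finite_induct) (auto simp: dual_space_0 intro: dual_space_add)

definition finite_rank :: "nat \<Rightarrow> (nat \<Rightarrow> 'a \<Rightarrow>\<^sub>L 'k) \<Rightarrow> (nat \<Rightarrow> 'a) \<Rightarrow> 'a \<Rightarrow> 'a"
  where "finite_rank m g w x = (\<Sum>i<m. scale (blinfun_apply (g i) x) (w i))"

lemma bounded_operator_finite_rank:
  assumes "\<And>i. i < m \<Longrightarrow> g i \<in> dual_space scale"
  shows "bounded_operator scale UNIV UNIV (finite_rank m g w)"
  unfolding bounded_operator_iff finite_rank_def
proof (intro conjI allI)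
  show "bounded_linear (\<lambda>x. \<Sum>i<m. scale (blinfun_apply (g i) x) (w i))"
    by (intro bounded_linear_sum bounded_linear_compose[OF bounded_linear_scale_left]
        blinfun.bounded_linear_right)
  show "(\<Sum>i<m. scale (blinfun_apply (g i) (scale c x)) (w i)) =
      scale c (\<Sum>i<m. scale (blinfun_apply (g i) x) (w i))" for c x
    unfolding scale_sum_right by (intro sum.cong) (simp_all add: apply_scale assms)
qed

lemma apply_finite_rank:
  "h \<in> dual_space scale \<Longrightarrow>
    blinfun_apply h (finite_rank m g w x) = (\<Sum>i<m. blinfun_apply (g i) x * blinfun_apply h (w i))"
  by (simp add: finite_rank_def blinfun.sum_right apply_scale)

text \<open>
  Projections with kernel \<open>Y\<close> exist, and in a form that displays their finite rank. In the
  induction step, \<open>q\<close> is the error that the operator found so far makes on the new functional \<open>a\<close>;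
  if it does not vanish, it is corrected by a rank-one term whose direction \<open>y\<close> is invisible to the
  previous functionals and normalised by \<open>a\<close>.
\<close>

lemma finite_rank_resolution:
  obtains m g v where "\<And>i. i < m \<Longrightarrow> g i \<in> W" "\<And>x. x - finite_rank m g v x \<in> Y"
proof -
  have "\<exists>m g v. (\<forall>i<m. g i \<in> dual.span B) \<and>
      (\<forall>x. \<forall>b\<in>B. blinfun_apply b (x - finite_rank m g v x) = 0)" if "B \<subseteq> A" for B
    using finite_subset[OF that finite_A] that
  proof (induction B rule: finite_induct)
    case empty
    show ?case by (rule exI[of _ 0]) simp
  next
    case (insert a B)
    then obtain m g v where IH: "\<forall>i<m. g i \<in> dual.span B"
      "\<forall>x. \<forall>b\<in>B. blinfun_apply b (x - finite_rank m g v x) = 0" by auto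
    have 0: "blinfun_apply b (x - finite_rank m g v x) = 0" if "b \<in> B" for x b
      using IH(2) that by blast
    have a: "a \<in> dual_space scale" and B: "B \<subseteq> dual_space scale" using insert.prems A_dual by auto
    have g': "g i \<in> dual.span (insert a B)" if "i < m" for i
      using IH(1) that dual.span_mono[of B "insert a B"] by blast
    define q where "q = a - (\<Sum>i<m. dual_scale (blinfun_apply a (v i)) (g i))"
    have q: "q \<in> dual.span (insert a B)"
      unfolding q_def
  proof (rule dual.span_diff)
    show "(\<Sum>i<m. dual_scale (blinfun_apply a (v i)) (g i)) \<in> dual.span (insert a B)"
      by (intro dual.span_sum dual.span_scale) (use g' in simp)
  qed (simp add: dual.span_base)
    have q_apply: "blinfun_apply q x = blinfun_apply a (x - finite_rank m g v x)" for x
      by (simp add: q_def blinfun.diff_left blinfun.sum_left dual_scale_apply blinfun.diff_right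
          apply_finite_rank[OF a] mult.commute)
    show ?case
    proof (cases "q = 0")
      case True
      then show ?thesis
        using g' 0 q_apply by (intro exI[of _ m] exI[of _ g] exI[of _ v]) auto
    next
      case False
      then obtain x where x: "blinfun_apply q x \<noteq> 0" by (metis blinfun_eqI zero_blinfun.rep_eq)
      define y where "y = scale (inverse (blinfun_apply q x)) (x - finite_rank m g v x)"
      have ay: "blinfun_apply a y = 1"
        using x by (simp add: y_def apply_scale[OF a] flip: q_apply)
      have apply_y: "blinfun_apply b y = 0" if "b \<in> B" for b
        using 0[OF that] B that by (simp add: y_def apply_scale subset_iff)
      let ?g = "g(m := q)" and ?v = "v(m := y)"
      have eq: "finite_rank (Suc m) ?g ?v z = finite_rank m g v z + scale (blinfun_apply q z) y" for z
        by (simp add: finite_rank_def)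
      have "blinfun_apply b (z - finite_rank (Suc m) ?g ?v z) = 0" if "b \<in> insert a B" for b z
      proof -
        have b: "b \<in> dual_space scale" using that a B by auto
        have "blinfun_apply b (z - finite_rank (Suc m) ?g ?v z) =
            blinfun_apply b (z - finite_rank m g v z) - blinfun_apply q z * blinfun_apply b y"
          by (simp add: eq blinfun.diff_right blinfun.add_right apply_scale[OF b] algebra_simps)
        then show ?thesis using that ay apply_y 0 by (auto simp: q_apply)
      qed
      moreover have "?g i \<in> dual.span (insert a B)" if "i < Suc m" for i
        using that g' q by (auto simp: less_Suc_eq)
      ultimately show ?thesis by blast
    qed
  qed
  from this[of A] show ?thesis using that by (auto simp: W_eq Y_eq)
qed

lemma W_iff: "g \<in> W \<longleftrightarrow> g \<in> dual_space scale \<and> (\<forall>y\<in>Y. blinfun_apply g y = 0)"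
proof
  assume h: "g \<in> dual_space scale \<and> (\<forall>y\<in>Y. blinfun_apply g y = 0)"
  obtain m b v where b: "\<And>i. i < m \<Longrightarrow> b i \<in> W" and res: "\<And>x. x - finite_rank m b v x \<in> Y"
    using finite_rank_resolution by blast
  have "blinfun_apply g x = blinfun_apply (\<Sum>i<m. dual_scale (blinfun_apply g (v i)) (b i)) x" for x
  proof -
    have "blinfun_apply g (x - finite_rank m b v x) = 0" using h res by blast
    then show ?thesis
      using h by (simp add: blinfun.diff_right apply_finite_rank blinfun.sum_left dual_scale_apply mult.commute)
  qed
  then have "g = (\<Sum>i<m. dual_scale (blinfun_apply g (v i)) (b i))" by (rule blinfun_eqI)
  also have "\<dots> \<in> W"
    unfolding W_eq by (intro dual.span_sum dual.span_scale) (use b W_eq in auto)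
  finally show "g \<in> W" .
qed (use W_dual W_apply_Y in auto)

lemma Y_iff: "x \<in> Y \<longleftrightarrow> (\<forall>g\<in>W. blinfun_apply g x = 0)"
  using W_apply_Y by (auto simp: Y_eq W_eq intro: dual.span_base)

text \<open>
  An operator that vanishes on \<open>Y\<close> depends on \<open>x\<close> only through the finitely many functionals of a
  resolution. One finite net therefore serves all these operators at once, which makes their
  image of the unit ball totally bounded and lets finitely many points determine their norm up to
  an arbitrarily small relative error.
\<close>

lemma finite_net_for_operators:
  assumes d: "0 < d"
  obtains U where "finite U" "\<And>u. u \<in> U \<Longrightarrow> norm u \<le> 1"
    "\<And>x. norm x \<le> 1 \<Longrightarrow> \<exists>u\<in>U. \<forall>T. bounded_operator scale UNIV UNIV T \<longrightarrow> (\<forall>y\<in>Y. T y = 0) \<longrightarrow>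
      norm (T x - T u) \<le> d * onorm T"
proof -
  obtain m g v where g: "\<And>i. i < m \<Longrightarrow> g i \<in> W" and res: "\<And>x. x - finite_rank m g v x \<in> Y"
    using finite_rank_resolution by blast
  define C where "C = (\<Sum>i<m. norm (v i))"
  have C: "0 \<le> C" by (simp add: C_def sum_nonneg)
  define e where "e = d / (C + 1)"
  have e: "0 < e" "e * C \<le> d" using C d by (auto simp: e_def field_simps)
  obtain U where U: "finite U" "\<And>u. u \<in> U \<Longrightarrow> norm u \<le> 1"
    "\<And>x. norm x \<le> 1 \<Longrightarrow> \<exists>u\<in>U. \<forall>h\<in>g ` {..<m}. norm (blinfun_apply h (x - u)) \<le> e"
    using finite_net_for_functionals[of "g ` {..<m}" e] e by auto
  have "norm (T x - T u) \<le> d * onorm T"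
    if T: "bounded_operator scale UNIV UNIV T" and T0: "\<forall>y\<in>Y. T y = 0"
      and u: "\<forall>h\<in>g ` {..<m}. norm (blinfun_apply h (x - u)) \<le> e" for T x u
  proof -
    have lin: "bounded_linear T" and T_scale: "\<And>c x. T (scale c x) = scale c (T x)"
      using T bounded_operator_iff by auto
    interpret T: bounded_linear T by fact
    define z where "z = x - u"
    have "T z = T (finite_rank m g v z)"
      using T0[rule_format, OF res[of z]] by (simp add: T.diff)
    also have "\<dots> = (\<Sum>i<m. scale (blinfun_apply (g i) z) (T (v i)))"
      by (simp add: finite_rank_def T.sum T_scale)
    also have "norm \<dots> \<le> (\<Sum>i<m. e * (onorm T * norm (v i)))"
    proof (rule sum_norm_le)
      fix i assume "i \<in> {..<m}"
      then have "norm (blinfun_apply (g i) z) \<le> e" using u by (auto simp: z_def)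
      then show "norm (scale (blinfun_apply (g i) z) (T (v i))) \<le> e * (onorm T * norm (v i))"
        unfolding norm_scale using onorm[OF lin, of "v i"] e(1) by (intro mult_mono) auto
    qed
    also have "\<dots> = (e * C) * onorm T"
      by (simp add: C_def sum_distrib_left sum_distrib_right algebra_simps)
    also have "\<dots> \<le> d * onorm T" by (rule mult_right_mono[OF e(2) onorm_pos_le[OF lin]])
    finally show ?thesis by (simp add: z_def T.diff)
  qed
  note close = this
  show ?thesis
  proof (rule that[of U])
    fix x :: 'a assume "norm x \<le> 1"
    from U(3)[OF this] obtain u where "u \<in> U" "\<forall>h\<in>g ` {..<m}. norm (blinfun_apply h (x - u)) \<le> e" ..
    then show "\<exists>u\<in>U. \<forall>T. bounded_operator scale UNIV UNIV T \<longrightarrow> (\<forall>y\<in>Y. T y = 0) \<longrightarrow>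
        norm (T x - T u) \<le> d * onorm T"
      using close by (intro bexI[of _ u]) auto
  qed (use U in auto)
qed

end

section \<open>Approximating projections of the dual by weak* continuous ones\<close>

lemma bounded_operator_sum_dual:
  assumes Q: "bounded_operator dual_scale F E Q"
    and F0: "0 \<in> F" and F_add: "\<And>x y. x \<in> F \<Longrightarrow> y \<in> F \<Longrightarrow> x + y \<in> F"
    and F_scale: "\<And>c x. x \<in> F \<Longrightarrow> dual_scale c x \<in> F"
    and h: "\<And>k. k < N \<Longrightarrow> h k \<in> F"
  shows "Q (\<Sum>k<N. dual_scale (c k) (h k)) = (\<Sum>k<(N::nat). dual_scale (c k) (Q (h k)))"
proof -
  have "(\<Sum>k<N. dual_scale (c k) (h k)) \<in> F \<and>
    Q (\<Sum>k<N. dual_scale (c k) (h k)) = (\<Sum>k<N. dual_scale (c k) (Q (h k)))"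
    using h
  proof (induction N)
    case 0
    have "Q (dual_scale 0 0) = dual_scale 0 (Q 0)" using Q F0 unfolding bounded_operator_def by blast
    then show ?case using F0 by simp
  next
    case (Suc N)
    then have "(\<Sum>k<N. dual_scale (c k) (h k)) \<in> F" "dual_scale (c N) (h N) \<in> F"
      using F_scale by auto
    then show ?case using Q Suc F_add unfolding bounded_operator_def by simp
  qed
  then show ?thesis by blast
qed

text \<open>
  The bounded sequences in a normed space form a normed space under the supremum norm. Sequences that
  vanish from some index on stand in for the finite powers of the space, whose length would otherwise
  have to be a type.
\<close>

definition unit_sequence :: "nat \<Rightarrow> 'a::real_normed_vector \<Rightarrow> (nat \<Rightarrow>\<^sub>C 'a)"
  where "unit_sequence k y = Bcontfun (\<lambda>i. if i = k then y else 0)"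

lemma apply_Bcontfun_nat:
  fixes z :: "nat \<Rightarrow> 'a::real_normed_vector"
  assumes "\<And>k. norm (z k) \<le> C"
  shows "apply_bcontfun (Bcontfun z) = z"
  by (intro Bcontfun_inverse bcontfun_normI) (use assms in auto)

lemma apply_unit_sequence: "apply_bcontfun (unit_sequence k y) i = (if i = k then y else 0)"
  unfolding unit_sequence_def by (subst apply_Bcontfun_nat[where C = "norm y"]) auto

lemma unit_sequence_add: "unit_sequence k (x + y) = unit_sequence k x + unit_sequence k y"
  by (rule bcontfun_eqI) (simp add: apply_unit_sequence)

lemma unit_sequence_scaleR: "unit_sequence k (c *\<^sub>R x) = c *\<^sub>R unit_sequence k x"
  by (rule bcontfun_eqI) (simp add: apply_unit_sequence)

lemma norm_unit_sequence: "norm (unit_sequence k y) \<le> norm y"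
  by (rule norm_bound) (simp add: apply_unit_sequence)

lemma apply_bcontfun_sum: "apply_bcontfun (\<Sum>k\<in>I. z k) i = (\<Sum>k\<in>I. apply_bcontfun (z k) i)"
  by (induction I rule: infinite_finite_induct) auto

lemma apply_sum_unit_sequences:
  "apply_bcontfun (\<Sum>k<N. unit_sequence k (x k)) i = (if i < N then x i else 0)"
  by (simp add: apply_bcontfun_sum apply_unit_sequence)

lemma sequence_eq_sum_unit_sequences:
  assumes "\<And>i. N \<le> i \<Longrightarrow> apply_bcontfun z i = 0"
  shows "z = (\<Sum>k<N. unit_sequence k (apply_bcontfun z k))"
  by (rule bcontfun_eqI) (use assms in \<open>auto simp: apply_sum_unit_sequences\<close>)

context banach_space_over
begin

text \<open>
  The coordinates of a functional for the supremum norm have summable norms: testing the functional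
  on one sequence whose entries nearly norm all coordinates simultaneously bounds the sum.
\<close>

lemma sequence_functional_coordinates:
  assumes F: "linear F" "\<And>z :: nat \<Rightarrow>\<^sub>C 'a. F z \<le> norm z"
  obtains h where "\<And>k. h k \<in> dual_space scale"
    "\<And>k x. re_part (blinfun_apply (h k) x) = F (unit_sequence k x)"
    "\<And>N. (\<Sum>k<N. norm (h k)) \<le> 1"
proof -
  have "\<exists>h. h \<in> dual_space scale \<and> (\<forall>x. re_part (blinfun_apply h x) = F (unit_sequence k x))" for k
  proof -
    have "linear (\<lambda>x. F (unit_sequence k x))"
      by (rule linearI)
        (simp_all add: unit_sequence_add unit_sequence_scaleR linear_add[OF F(1)] linear_scale[OF F(1)])
    moreover have "F (unit_sequence k x) \<le> 1 * norm x" for x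
      using F(2)[of "unit_sequence k x"] norm_unit_sequence[of k x] by simp
    ultimately show ?thesis by (rule real_functional_is_real_part[of _ 1]) auto
  qed
  then obtain h where h: "\<And>k. h k \<in> dual_space scale"
    and re_h: "\<And>k x. re_part (blinfun_apply (h k) x) = F (unit_sequence k x)" by metis
  have "(\<Sum>k<N. norm (h k)) \<le> 1" for N
  proof (rule field_le_epsilon)
    fix e :: real assume e: "0 < e"
    define d where "d = e / (real N + 1)"
    have d: "0 < d" "N * d \<le> e" using e by (auto simp: d_def field_simps)
    have "\<exists>x. norm x \<le> 1 \<and> norm (h k) - d < re_part (blinfun_apply (h k) x)" for k
      using slice_nonempty[OF h, of "norm (h k) - d" k] d by auto
    then obtain x where x: "\<And>k. norm (x k) \<le> 1"
      "\<And>k. norm (h k) - d < re_part (blinfun_apply (h k) (x k))" by metis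
    have "(\<Sum>k<N. norm (h k)) - N * d = (\<Sum>k<N. norm (h k) - d)"
      by (simp add: sum_subtractf)
    also have "\<dots> \<le> (\<Sum>k<N. F (unit_sequence k (x k)))"
      by (rule sum_mono) (use x(2) re_h in \<open>simp add: less_imp_le\<close>)
    also have "\<dots> = F (\<Sum>k<N. unit_sequence k (x k))" by (simp add: linear_sum[OF F(1)])
    also have "\<dots> \<le> norm (\<Sum>k<N. unit_sequence k (x k))" by (rule F(2))
    also have "\<dots> \<le> 1" by (rule norm_bound) (simp add: apply_sum_unit_sequences x)
    finally show "(\<Sum>k<N. norm (h k)) \<le> 1 + e" using d(2) by simp
  qed
  with h re_h show ?thesis by (rule that)
qed

end

context common_kernel
begin

text \<open>
  These are the projections with kernel \<open>Y\<close>: the conditions imply \<open>T (T x) = T x\<close>, and \<open>T x = 0\<close>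
  forces \<open>x\<close> into \<open>Y\<close>.
\<close>

definition projection_along :: "('a \<Rightarrow> 'a) \<Rightarrow> bool"
  where "projection_along T \<longleftrightarrow> bounded_operator scale UNIV UNIV T \<and> (\<forall>y\<in>Y. T y = 0) \<and> (\<forall>x. x - T x \<in> Y)"

lemma finite_rank_zero_on_Y:
  assumes "\<And>i. i < m \<Longrightarrow> g i \<in> W" "y \<in> Y"
  shows "finite_rank m g w y = 0"
  unfolding finite_rank_def by (rule sum.neutral) (use assms W_apply_Y in auto)

lemma finite_rank_in_Y: "(\<And>i. w i \<in> Y) \<Longrightarrow> finite_rank m g w x \<in> Y"
  unfolding finite_rank_def by (induction m) (auto simp: Y_0 intro: Y_add Y_scale)

lemma finite_rank_add: "finite_rank m g (\<lambda>i. v i + w i) x = finite_rank m g v x + finite_rank m g w x"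
  and finite_rank_diff: "finite_rank m g (\<lambda>i. v i - w i) x = finite_rank m g v x - finite_rank m g w x"
  and finite_rank_0: "finite_rank m g (\<lambda>i. 0) x = 0"
  by (simp_all add: finite_rank_def scale_right_distrib scale_right_diff_distrib sum.distrib sum_subtractf)

lemma finite_rank_scaleR: "finite_rank m g (\<lambda>i. r *\<^sub>R w i) x = r *\<^sub>R finite_rank m g w x"
  by (simp add: finite_rank_def scale_sum_right mult.commute flip: scale_of_real)

lemma finite_rank_single:
  assumes "i < m"
  shows "finite_rank m g (\<lambda>l. if l = i then y else 0) x = scale (blinfun_apply (g i) x) y"
proof -
  have "finite_rank m g (\<lambda>l. if l = i then y else 0) x =
      (\<Sum>l<m. if l = i then scale (blinfun_apply (g i) x) y else 0)"
    unfolding finite_rank_def by (rule sum.cong) auto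
  then show ?thesis using assms by simp
qed

text \<open>
  This is the part of the principle of local reflexivity that is needed here, restricted to finitely
  many points \<open>u k\<close>. The projections with kernel \<open>Y\<close> of the form considered differ from
  \<open>R v\<close> by operators \<open>R w\<close> with values in \<open>Y\<close>, so the claim bounds the distance of the
  sequence \<open>R v (u k)\<close> from the subspace \<open>D\<close> of the sequences \<open>R w (u k)\<close>. A Hahn-Banach functional
  computes this distance as \<open>Re (\<Sum>k. h k (R v (u k)))\<close> with \<open>(\<Sum>k. norm (h k)) \<le> 1\<close>. That it
  vanishes on \<open>D\<close> means that each \<open>G i = (\<Sum>k. g i (u k) h k)\<close> annihilates \<open>Y\<close>, that is, lies in \<open>W\<close>
  and is fixed by \<open>Q\<close>. Therefore every \<open>h k\<close> may be replaced by \<open>Q (h k)\<close> in the sum; as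
  \<open>Q (h k)\<close> lies in \<open>W\<close>, it does not distinguish \<open>R v (u k)\<close> from \<open>u k\<close>, and the sum is at most
  the norm of \<open>Q\<close>.
\<close>

lemma weak_star_continuous_approximation_at_points:
  fixes u :: "nat \<Rightarrow> 'a"
  assumes Q: "projection dual_scale W (dual_space scale) Q"
    and g: "\<And>i. i < m \<Longrightarrow> g i \<in> W" and res: "\<And>x. x - finite_rank m g v x \<in> Y"
    and u: "\<And>k. norm (u k) \<le> 1" and u0: "\<And>k. N \<le> k \<Longrightarrow> u k = 0"
    and q: "onorm_on (dual_space scale) Q < q"
  obtains w where "\<And>i. w i \<in> Y"
    "\<And>k. norm (finite_rank m g v (u k) - finite_rank m g w (u k)) < q"
proof -
  let ?X' = "dual_space scale"
  define R where "R = finite_rank m g"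
  define seq where "seq w = Bcontfun (\<lambda>k. R w (u k))" for w
  define D where "D = seq ` {w. \<forall>i. w i \<in> Y}"
  have g': "g i \<in> ?X'" if "i < m" for i using W_dual g that by blast
  have lin_R: "bounded_linear (R w)" for w
    unfolding R_def by (rule bounded_operator_bounded_linear[OF bounded_operator_finite_rank[OF g']])
  have seq: "apply_bcontfun (seq w) k = R w (u k)" for w k
  proof -
    have "norm (R w (u k)) \<le> onorm (R w)" for k
      using onorm[OF lin_R, of w "u k"] mult_left_mono[OF u onorm_pos_le[OF lin_R], of w k] by simp
    from apply_Bcontfun_nat[OF this] show ?thesis by (simp add: seq_def)
  qed
  have seq_0: "seq (\<lambda>_. 0) = 0" by (rule bcontfun_eqI) (simp add: seq R_def finite_rank_0)
  have seq_add: "seq w + seq w' = seq (\<lambda>i. w i + w' i)" for w w'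
    by (rule bcontfun_eqI) (simp add: seq R_def finite_rank_add)
  have seq_scaleR: "r *\<^sub>R seq w = seq (\<lambda>i. r *\<^sub>R w i)" for r w
    by (rule bcontfun_eqI) (simp add: seq R_def finite_rank_scaleR)
  have D: "Real_Vector_Spaces.subspace D"
  proof (rule real_vector.subspaceI)
    show "0 \<in> D" unfolding D_def seq_0[symmetric] using Y_0 by blast
    show "x + y \<in> D" if "x \<in> D" "y \<in> D" for x y
      using that unfolding D_def by (auto simp: seq_add intro!: imageI Y_add)
    show "r *\<^sub>R x \<in> D" if "x \<in> D" for r x
      using that unfolding D_def by (auto simp: seq_scaleR intro!: imageI Y_scaleR)
  qed
  obtain F where F: "linear F" "\<And>z. F z \<le> norm z" "\<And>z. z \<in> D \<Longrightarrow> F z = 0" "F (seq v) = infdist (seq v) D"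
    using Hahn_Banach_subspace[OF D] by blast
  obtain h where h: "\<And>k. h k \<in> ?X'" and re_h: "\<And>k x. re_part (blinfun_apply (h k) x) = F (unit_sequence k x)"
    and sum_h: "\<And>N. (\<Sum>k<N. norm (h k)) \<le> 1"
    using sequence_functional_coordinates[OF F(1,2)] by metis
  have F_seq: "F (seq w) = (\<Sum>k<N. re_part (blinfun_apply (h k) (R w (u k))))" for w
  proof -
    have "seq w = (\<Sum>k<N. unit_sequence k (apply_bcontfun (seq w) k))"
      by (rule sequence_eq_sum_unit_sequences)
        (simp add: seq u0 linear_0[OF bounded_linear.linear[OF lin_R]])
    then show ?thesis using linear_sum[OF F(1)] by (metis (no_types, lifting) re_h seq sum.cong)
  qed
  define G where "G i = (\<Sum>k<N. dual_scale (blinfun_apply (g i) (u k)) (h k))" for i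
  have G: "G i \<in> W" if i: "i < m" for i
  proof -
    have "blinfun_apply (G i) y = 0" if y: "y \<in> Y" for y
    proof (rule eq_0_if_re_part_multiples)
      fix c
      let ?w = "\<lambda>l. if l = i then scale c y else 0"
      have "seq ?w \<in> D" using y Y_0 Y_scale by (auto simp: D_def)
      then have "0 = F (seq ?w)" using F(3) by simp
      also have "\<dots> = (\<Sum>k<N. re_part (c * (blinfun_apply (g i) (u k) * blinfun_apply (h k) y)))"
        unfolding F_seq R_def finite_rank_single[OF i] by (simp add: apply_scale[OF h] mult_ac)
      also have "\<dots> = re_part (c * blinfun_apply (G i) y)"
        by (simp add: G_def blinfun.sum_left dual_scale_apply sum_distrib_left flip: re_part_sum)
      finally show "re_part (c * blinfun_apply (G i) y) = 0" by simp
    qed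
    moreover have "G i \<in> ?X'" unfolding G_def by (intro dual_space_sum dual_space_scale h)
    ultimately show ?thesis by (simp add: W_iff)
  qed
  have Q_op: "bounded_operator dual_scale ?X' W Q" and Q_id: "\<And>g. g \<in> W \<Longrightarrow> Q g = g"
    using Q by (auto simp: projection_def)
  have Q_W: "Q g \<in> W" if "g \<in> ?X'" for g using Q_op that by (auto simp: bounded_operator_def)
  have Q_G: "G i = (\<Sum>k<N. dual_scale (blinfun_apply (g i) (u k)) (Q (h k)))" if "i < m" for i
    using bounded_operator_sum_dual[OF Q_op dual_space_0 dual_space_add dual_space_scale, of N h] h
      Q_id[OF G[OF that]] by (simp add: G_def)
  have "infdist (seq v) D = re_part (\<Sum>k<N. blinfun_apply (h k) (R v (u k)))"
    using F(4) F_seq by (simp add: re_part_sum)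
  also have "(\<Sum>k<N. blinfun_apply (h k) (R v (u k))) =
      (\<Sum>k<N. \<Sum>i<m. blinfun_apply (g i) (u k) * blinfun_apply (h k) (v i))"
    by (simp add: R_def apply_finite_rank[OF h])
  also have "\<dots> = (\<Sum>i<m. blinfun_apply (G i) (v i))"
    unfolding G_def by (subst sum.swap) (simp add: blinfun.sum_left dual_scale_apply)
  also have "\<dots> = (\<Sum>i<m. \<Sum>k<N. blinfun_apply (g i) (u k) * blinfun_apply (Q (h k)) (v i))"
    by (rule sum.cong) (simp_all add: Q_G blinfun.sum_left dual_scale_apply)
  also have "\<dots> = (\<Sum>k<N. blinfun_apply (Q (h k)) (R v (u k)))"
    by (subst sum.swap) (simp add: R_def apply_finite_rank W_dual Q_W h)
  also have "\<dots> = (\<Sum>k<N. blinfun_apply (Q (h k)) (u k))"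
  proof (rule sum.cong)
    fix k
    have "blinfun_apply (Q (h k)) (u k - R v (u k)) = 0"
      unfolding R_def by (rule W_apply_Y[OF Q_W[OF h] res])
    then show "blinfun_apply (Q (h k)) (R v (u k)) = blinfun_apply (Q (h k)) (u k)"
      by (simp add: blinfun.diff_right)
  qed simp
  also have "re_part \<dots> \<le> (\<Sum>k<N. onorm_on ?X' Q * norm (h k))"
    unfolding re_part_sum
  proof (rule sum_mono)
    fix k
    have "re_part (blinfun_apply (Q (h k)) (u k)) \<le> norm (Q (h k))"
      using re_part_blinfun_le[of "Q (h k)" "u k"] mult_left_mono[OF u, of "norm (Q (h k))" k] by simp
    then show "re_part (blinfun_apply (Q (h k)) (u k)) \<le> onorm_on ?X' Q * norm (h k)"
      using norm_le_onorm_on[OF Q_op h, of k] by simp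
  qed
  also have "\<dots> \<le> onorm_on ?X' Q"
    using mult_left_mono[OF sum_h onorm_on_nonneg[OF Q_op dual_space_0], of N]
    by (simp add: sum_distrib_left)
  finally have "infdist (seq v) D < q" using q by simp
  moreover have "D \<noteq> {}" using real_vector.subspace_0[OF D] by blast
  ultimately obtain z where "z \<in> D" "dist (seq v) z < q"
    using cInf_lessD[of "dist (seq v) ` D" q] by (auto simp: infdist_notempty)
  then obtain w where w: "\<And>i. w i \<in> Y" "dist (seq v) (seq w) < q" by (auto simp: D_def)
  have "norm (R v (u k) - R w (u k)) < q" for k
    using norm_bounded[of "seq v - seq w" k] w(2) by (simp add: seq dist_norm)
  from w(1) this[unfolded R_def] show ?thesis by (rule that)
qed

text \<open>
  The points \<open>u k\<close> of the previous lemma are chosen as a net that determines the norm of \<open>T\<close> up to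
  a factor \<open>1 - d\<close>.
\<close>

theorem weak_star_continuous_approximation:
  assumes Q: "projection dual_scale W (dual_space scale) Q" and e: "0 < e"
  obtains T where "projection_along T" "onorm T \<le> onorm_on (dual_space scale) Q + e"
proof -
  let ?q = "onorm_on (dual_space scale) Q"
  obtain m g v where g: "\<And>i. i < m \<Longrightarrow> g i \<in> W" and res: "\<And>x. x - finite_rank m g v x \<in> Y"
    using finite_rank_resolution by blast
  have q0: "0 \<le> ?q"
    using Q onorm_on_nonneg[OF _ dual_space_0] by (auto simp: projection_def)
  \<comment> \<open>Chosen so that dividing the bound \<open>?q + e / 2\<close> at the net points by \<open>1 - d\<close> gives \<open>?q + e\<close>.\<close>
  define d where "d = (e / 2) / (?q + e)"
  have d: "0 < d" "d < 1" "(1 - d) * (?q + e) = ?q + e / 2"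
    using q0 e by (auto simp: d_def field_simps)
  obtain U where U: "finite U" "\<And>u. u \<in> U \<Longrightarrow> norm u \<le> 1"
    "\<And>x. norm x \<le> 1 \<Longrightarrow> \<exists>u\<in>U. \<forall>T. bounded_operator scale UNIV UNIV T \<longrightarrow> (\<forall>y\<in>Y. T y = 0) \<longrightarrow>
      norm (T x - T u) \<le> d * onorm T"
    using finite_net_for_operators[OF d(1)] by blast
  obtain u' and N :: nat where u': "U = u' ` {i. i < N}"
    using finite_imp_nat_seg_image_inj_on[OF U(1)] by blast
  define u where "u k = (if k < N then u' k else 0)" for k
  have "norm (u k) \<le> 1" for k using U(2) u' by (auto simp: u_def)
  moreover have "u k = 0" if "N \<le> k" for k using that by (simp add: u_def)
  ultimately obtain w where w: "\<And>i. w i \<in> Y"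
    "\<And>k. norm (finite_rank m g v (u k) - finite_rank m g w (u k)) < ?q + e / 2"
    using weak_star_continuous_approximation_at_points[OF Q g res, of u N "?q + e / 2"] e by auto
  define T where "T = finite_rank m g (\<lambda>i. v i - w i)"
  have T: "bounded_operator scale UNIV UNIV T"
    unfolding T_def by (rule bounded_operator_finite_rank) (use g W_dual in blast)
  then have lin: "bounded_linear T" by (rule bounded_operator_bounded_linear)
  have T0: "\<forall>y\<in>Y. T y = 0" using finite_rank_zero_on_Y[OF g] by (simp add: T_def)
  have "x - T x \<in> Y" for x
    using Y_add[OF res[of x] finite_rank_in_Y[of w m g x]] w(1)
    by (simp add: T_def finite_rank_diff algebra_simps)
  then have along: "projection_along T" using T T0 by (simp add: projection_along_def)
  have bound: "norm (T x) \<le> ?q + e / 2 + d * onorm T" if x: "norm x \<le> 1" for x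
  proof -
    obtain y where y: "y \<in> U" "norm (T x - T y) \<le> d * onorm T" using U(3)[OF x] T T0 by blast
    then obtain k where "k < N" "y = u' k" using u' by blast
    then have "y = u k" by (simp add: u_def)
    then have "norm (T y) < ?q + e / 2" using w(2) by (simp add: T_def finite_rank_diff)
    then show ?thesis using y(2) norm_triangle_sub[of "T x" "T y"] by linarith
  qed
  have "onorm T \<le> ?q + e / 2 + d * onorm T"
  proof (rule ccontr)
    assume "\<not> ?thesis"
    then obtain x where "norm x \<le> 1" "?q + e / 2 + d * onorm T < norm (T x)"
      using onorm_nearly_attained[OF lin, of "?q + e / 2 + d * onorm T"] by auto
    then show False using bound[of x] by simp
  qed
  then have "(1 - d) * onorm T \<le> (1 - d) * (?q + e)" unfolding d(3) by (simp add: algebra_simps)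
  then have "onorm T \<le> ?q + e" using d(2) by simp
  with along show ?thesis by (rule that)
qed

end

section \<open>Weak* continuous projections and projections with kernel Y\<close>

context banach_space_over
begin

text \<open>
  A functional on the dual that vanishes where finitely many evaluations vanish is a linear combination
  of these evaluations, and hence itself the evaluation at some point.
\<close>

lemma functional_is_evaluation:
  fixes \<psi> :: "('a \<Rightarrow>\<^sub>L 'k) \<Rightarrow> 'k"
  assumes "finite F"
    and "\<And>g h. g \<in> dual_space scale \<Longrightarrow> h \<in> dual_space scale \<Longrightarrow> \<psi> (g + h) = \<psi> g + \<psi> h"
    and "\<And>c g. g \<in> dual_space scale \<Longrightarrow> \<psi> (dual_scale c g) = c * \<psi> g"
    and "\<And>g. g \<in> dual_space scale \<Longrightarrow> \<forall>x\<in>F. blinfun_apply g x = 0 \<Longrightarrow> \<psi> g = 0"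
  shows "\<exists>y. \<forall>g\<in>dual_space scale. \<psi> g = blinfun_apply g y"
  using assms
proof (induction F arbitrary: \<psi> rule: finite_induct)
  case empty
  then show ?case by (intro exI[of _ 0]) simp
next
  case (insert a F)
  show ?case
  proof (cases "\<exists>g\<in>dual_space scale. (\<forall>x\<in>F. blinfun_apply g x = 0) \<and> blinfun_apply g a \<noteq> 0")
    case False
    then show ?thesis by (intro insert.IH insert.prems(1,2)) (use insert.prems(3) in auto)
  next
    case True
    then obtain b where b: "b \<in> dual_space scale" "\<And>x. x \<in> F \<Longrightarrow> blinfun_apply b x = 0"
      "blinfun_apply b a \<noteq> 0" by blast
    define c where "c = \<psi> b / blinfun_apply b a"
    have "\<exists>y. \<forall>g\<in>dual_space scale. \<psi> g - c * blinfun_apply g a = blinfun_apply g y"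
    proof (rule insert.IH)
      show "\<psi> (g + h) - c * blinfun_apply (g + h) a =
          \<psi> g - c * blinfun_apply g a + (\<psi> h - c * blinfun_apply h a)"
        if "g \<in> dual_space scale" "h \<in> dual_space scale" for g h
        using insert.prems(1)[OF that] by (simp add: blinfun.add_left algebra_simps)
      show "\<psi> (dual_scale d g) - c * blinfun_apply (dual_scale d g) a = d * (\<psi> g - c * blinfun_apply g a)"
        if "g \<in> dual_space scale" for d g
        using insert.prems(2)[OF that] by (simp add: dual_scale_apply algebra_simps)
      show "\<psi> g - c * blinfun_apply g a = 0"
        if g: "g \<in> dual_space scale" "\<forall>x\<in>F. blinfun_apply g x = 0" for g
      proof -
        define t where "t = - (blinfun_apply g a / blinfun_apply b a)"
        have t: "blinfun_apply g a + t * blinfun_apply b a = 0" using b(3) by (simp add: t_def)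
        have "\<psi> (g + dual_scale t b) = 0"
          by (rule insert.prems(3))
            (use g b t in \<open>auto simp: blinfun.add_left dual_scale_apply intro: dual_space_add dual_space_scale\<close>)
        then have "\<psi> g + t * \<psi> b = 0"
          using insert.prems(1)[OF g(1) dual_space_scale[OF b(1)]] insert.prems(2)[OF b(1)] by simp
        then show ?thesis by (simp add: c_def t_def mult.commute)
      qed
    qed
    then obtain y where y: "\<And>g. g \<in> dual_space scale \<Longrightarrow> \<psi> g - c * blinfun_apply g a = blinfun_apply g y"
      by blast
    have "\<psi> g = blinfun_apply g (y + scale c a)" if "g \<in> dual_space scale" for g
      using y[OF that] by (simp add: blinfun.add_right apply_scale[OF that] algebra_simps)
    then show ?thesis by blast
  qed
qed

lemma topspace_weak_star: "topspace (weak_star_topology scale) = dual_space scale"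
  by (simp add: weak_star_topology_def strong_operator_topology_topspace)

lemma weak_star_neighbourhood_of_0:
  assumes V: "openin (weak_star_topology scale) V" "0 \<in> V"
  obtains F where "finite F"
    "\<And>g. g \<in> dual_space scale \<Longrightarrow> \<forall>x\<in>F. blinfun_apply g x = 0 \<Longrightarrow> g \<in> V"
proof -
  obtain V' where V': "openin strong_operator_topology V'" "V = V' \<inter> dual_space scale"
    using V(1) by (auto simp: weak_star_topology_def openin_subtopology)
  then obtain U :: "('a \<Rightarrow> 'k) set" where U: "open U" "V' = blinfun_apply -` U"
    by (auto simp: strong_operator_topology_def openin_pullback_topology)
  have "openin (product_topology (\<lambda>_. euclidean) UNIV) U" using U(1) by (simp add: euclidean_product_topology)
  moreover have "(\<lambda>_. 0) \<in> U" using V(2) V'(2) U(2) by (simp add: zero_blinfun.rep_eq)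
  ultimately obtain B :: "'a \<Rightarrow> 'k set" where B: "(\<lambda>_. 0) \<in> PiE UNIV B" "finite {x. B x \<noteq> UNIV}" "PiE UNIV B \<subseteq> U"
    using product_topology_open_contains_basis[of "\<lambda>_. euclidean" UNIV U "\<lambda>_. 0"] by auto
  show ?thesis
  proof (rule that[OF B(2)])
    fix g assume g: "g \<in> dual_space scale" "\<forall>x\<in>{x. B x \<noteq> UNIV}. blinfun_apply g x = 0"
    have "blinfun_apply g x \<in> B x" for x using g(2) B(1) by (cases "B x = UNIV") auto
    then have "blinfun_apply g \<in> U" using B(3) by blast
    then show "g \<in> V" using g(1) U(2) V'(2) by simp
  qed
qed

end

context common_kernel
begin

definition dual_map :: "('a \<Rightarrow> 'a) \<Rightarrow> ('a \<Rightarrow>\<^sub>L 'k) \<Rightarrow> ('a \<Rightarrow>\<^sub>L 'k)"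
  where "dual_map T g = g o\<^sub>L Blinfun T"

lemma projection_along_bounded_linear: "projection_along T \<Longrightarrow> bounded_linear T"
  by (auto simp: projection_along_def bounded_operator_bounded_linear)

lemma dual_map_apply: "projection_along T \<Longrightarrow> blinfun_apply (dual_map T g) x = blinfun_apply g (T x)"
  by (simp add: dual_map_def bounded_linear_Blinfun_apply projection_along_bounded_linear)

lemma norm_dual_map_le: "projection_along T \<Longrightarrow> norm (dual_map T g) \<le> onorm T * norm g"
  using norm_blinfun_compose[of g "Blinfun T"]
  by (simp add: dual_map_def norm_blinfun.rep_eq bounded_linear_Blinfun_apply projection_along_bounded_linear mult.commute)

lemma projection_dual_map:
  assumes T: "projection_along T"
  shows "projection dual_scale W (dual_space scale) (dual_map T)"
proof -
  have T_scale: "\<And>c x. T (scale c x) = scale c (T x)" and T0: "\<And>y. y \<in> Y \<Longrightarrow> T y = 0"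
    and TY: "\<And>x. x - T x \<in> Y"
    using T by (auto simp: projection_along_def bounded_operator_def)
  note [simp] = dual_map_apply[OF T]
  have "dual_map T g \<in> W" if "g \<in> dual_space scale" for g
    using that by (simp add: W_iff dual_space_def T_scale T0)
  moreover have "dual_map T (g + h) = dual_map T g + dual_map T h" for g h
    by (rule blinfun_eqI) (simp add: blinfun.add_left)
  moreover have "dual_map T (dual_scale c g) = dual_scale c (dual_map T g)" for c g
    by (rule blinfun_eqI) (simp add: dual_scale_apply)
  moreover have "dual_map T g = g" if "g \<in> W" for g
    by (rule blinfun_eqI) (use W_apply_Y[OF that TY] in \<open>simp add: blinfun.diff_right\<close>)
  ultimately show ?thesis
    using norm_dual_map_le[OF T] unfolding projection_def bounded_operator_def by blast
qed

text \<open>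
  A Banach space norms its elements by functionals, so the norm of \<open>T\<close> is already seen on the dual.
\<close>

lemma onorm_on_dual_map:
  assumes T: "projection_along T"
  shows "onorm_on (dual_space scale) (dual_map T) = onorm T"
proof (rule antisym)
  have lin: "bounded_linear T" by (rule projection_along_bounded_linear[OF T])
  show "onorm_on (dual_space scale) (dual_map T) \<le> onorm T"
    by (rule onorm_on_leI) (use dual_space_0 onorm_pos_le[OF lin] norm_dual_map_le[OF T] in auto)
  have Q: "bounded_operator dual_scale (dual_space scale) W (dual_map T)"
    using projection_dual_map[OF T] by (simp add: projection_def)
  let ?q = "onorm_on (dual_space scale) (dual_map T)"
  have q0: "0 \<le> ?q" by (rule onorm_on_nonneg[OF Q dual_space_0])
  show "onorm T \<le> ?q"
  proof (rule onorm_bound[OF q0])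
    fix x
    obtain k where k: "k \<in> dual_space scale" "norm k \<le> 1" "re_part (blinfun_apply k (T x)) = norm (T x)"
      using norming_functional by blast
    have "norm (T x) \<le> norm (dual_map T k) * norm x"
      using re_part_blinfun_le[of "dual_map T k" x] by (simp add: dual_map_apply[OF T] k(3))
    also have "norm (dual_map T k) \<le> ?q"
      using norm_le_onorm_on[OF Q k(1)] mult_left_mono[OF k(2) q0] by simp
    finally show "norm (T x) \<le> ?q * norm x" by (simp add: mult_right_mono)
  qed
qed

lemma dual_map_weak_star_continuous:
  assumes T: "projection_along T"
  shows "weak_star_continuous scale W (dual_map T)"
proof -
  obtain m b v where b: "\<And>i. i < m \<Longrightarrow> b i \<in> W" and res: "\<And>x. x - finite_rank m b v x \<in> Y"
    using finite_rank_resolution by blast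
  have T_op: "bounded_operator scale UNIV UNIV T" and T0: "\<And>y. y \<in> Y \<Longrightarrow> T y = 0"
    using T by (auto simp: projection_along_def)
  interpret T: bounded_linear T by (rule projection_along_bounded_linear[OF T])
  have T_scale: "T (scale c x) = scale c (T x)" for c x using T_op by (simp add: bounded_operator_def)
  have eq: "dual_map T g = (\<Sum>i<m. dual_scale (blinfun_apply g (T (v i))) (b i))"
    if g: "g \<in> dual_space scale" for g
  proof (rule blinfun_eqI)
    fix x
    have "T x = T (finite_rank m b v x)" using T0[OF res[of x]] by (simp add: T.diff)
    then show "blinfun_apply (dual_map T g) x =
        blinfun_apply (\<Sum>i<m. dual_scale (blinfun_apply g (T (v i))) (b i)) x"
      by (simp add: dual_map_apply[OF T] finite_rank_def T.sum T_scale blinfun.sum_right blinfun.sum_left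
          apply_scale[OF g] dual_scale_apply mult.commute)
  qed
  have dual_scale_cont: "continuous_map euclidean euclidean (\<lambda>c. dual_scale c (g :: 'a \<Rightarrow>\<^sub>L 'k))" for g
  proof -
    have "bounded_linear (\<lambda>c. dual_scale c g)"
      by (rule bounded_linear_intro[where K = "norm g"])
        (auto intro!: blinfun_eqI
          simp: dual_scale_apply blinfun.add_left blinfun.scaleR_left distrib_right norm_dual_scale)
    then show ?thesis by (simp add: linear_continuous_on)
  qed
  have "continuous_map (weak_star_topology scale) euclidean
      (\<lambda>g. \<Sum>i<m. dual_scale (blinfun_apply g (T (v i))) (b i))"
  proof (rule continuous_map_sum)
    show "continuous_map (weak_star_topology scale) euclidean
        (\<lambda>g. dual_scale (blinfun_apply g (T (v i))) (b i))" for i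
      using continuous_map_compose[OF
          continuous_map_from_subtopology[OF strong_operator_topology_continuous_evaluation] dual_scale_cont]
      by (simp add: weak_star_topology_def o_def)
  qed simp
  then have "continuous_map (weak_star_topology scale) euclidean (dual_map T)"
    by (rule continuous_map_eq) (simp add: topspace_weak_star eq)
  moreover have "dual_map T g \<in> W" if "g \<in> dual_space scale" for g
    using projection_dual_map[OF T] that by (simp add: projection_def bounded_operator_def)
  ultimately show ?thesis
    by (simp add: weak_star_continuous_def continuous_map_in_subtopology topspace_weak_star)
qed

text \<open>
  Weak* continuity at \<open>0\<close> into the norm topology gives a finite set \<open>F\<close> such that \<open>norm (Q g) < 1\<close>, and
  after scaling \<open>Q g = 0\<close>, whenever \<open>g\<close> vanishes on \<open>F\<close>. For every \<open>x\<close>, the functional \<open>g \<mapsto> (Q g) x\<close> is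
  therefore an evaluation at a point, which is the value \<open>T x\<close>. Everything that \<open>T\<close> has to satisfy
  can be tested by functionals and is inherited from \<open>Q\<close>.
\<close>

lemma weak_star_continuous_projection_is_dual_map:
  assumes Q: "projection dual_scale W (dual_space scale) Q"
    and cont: "weak_star_continuous scale W Q"
  obtains T where "projection_along T" "\<And>g. g \<in> dual_space scale \<Longrightarrow> Q g = dual_map T g"
proof -
  let ?X' = "dual_space scale"
  have Q_op: "bounded_operator dual_scale ?X' W Q" and Q_id: "\<And>g. g \<in> W \<Longrightarrow> Q g = g"
    using Q by (auto simp: projection_def)
  have Q_W: "Q g \<in> W" if "g \<in> ?X'" for g using Q_op that by (auto simp: bounded_operator_def)
  have Q_add: "Q (g + h) = Q g + Q h" if "g \<in> ?X'" "h \<in> ?X'" for g h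
    using Q_op that by (auto simp: bounded_operator_def)
  have Q_scale: "Q (dual_scale c g) = dual_scale c (Q g)" if "g \<in> ?X'" for c g
    using Q_op that by (auto simp: bounded_operator_def)
  have Q0: "Q 0 = 0" using Q_scale[OF dual_space_0, of 0] by simp
  define V where "V = {g \<in> topspace (weak_star_topology scale). Q g \<in> W \<inter> ball 0 1}"
  have "openin (weak_star_topology scale) V"
    unfolding V_def
    by (rule openin_continuous_map_preimage[OF cont[unfolded weak_star_continuous_def]])
      (simp add: openin_open_Int)
  moreover have "0 \<in> V" using Q_W[OF dual_space_0] by (simp add: V_def topspace_weak_star dual_space_0 Q0)
  ultimately obtain F where F: "finite F" "\<And>g. g \<in> ?X' \<Longrightarrow> \<forall>x\<in>F. blinfun_apply g x = 0 \<Longrightarrow> g \<in> V"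
    using weak_star_neighbourhood_of_0 by metis
  have Q_F: "Q g = 0" if g: "g \<in> ?X'" "\<forall>x\<in>F. blinfun_apply g x = 0" for g
  proof (rule ccontr)
    assume "Q g \<noteq> 0"
    let ?c = "of_real (1 / norm (Q g)) :: 'k"
    have "dual_scale ?c g \<in> V"
      by (rule F(2)) (use g in \<open>auto simp: dual_scale_apply intro: dual_space_scale\<close>)
    then have "norm (dual_scale ?c (Q g)) < 1" by (simp add: V_def Q_scale g)
    then show False using \<open>Q g \<noteq> 0\<close> by (simp add: norm_dual_scale norm_divide)
  qed
  have "\<exists>y. \<forall>g\<in>?X'. blinfun_apply (Q g) x = blinfun_apply g y" for x
    by (rule functional_is_evaluation[OF F(1)])
      (simp_all add: Q_add Q_scale Q_F blinfun.add_left dual_scale_apply)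
  then obtain T where T: "\<And>g x. g \<in> ?X' \<Longrightarrow> blinfun_apply (Q g) x = blinfun_apply g (T x)"
    by metis
  have T_add: "T (x + y) = T x + T y" for x y
    by (rule eq_if_functionals_eq) (simp add: blinfun.add_right flip: T)
  have T_scale: "T (scale c x) = scale c (T x)" for c x
    by (rule eq_if_functionals_eq) (simp add: apply_scale W_dual Q_W flip: T)
  let ?q = "onorm_on ?X' Q"
  have q0: "0 \<le> ?q" by (rule onorm_on_nonneg[OF Q_op dual_space_0])
  have "norm (T x) \<le> ?q * norm x" for x
  proof -
    obtain k where k: "k \<in> ?X'" "norm k \<le> 1" "re_part (blinfun_apply k (T x)) = norm (T x)"
      using norming_functional by blast
    have "norm (T x) \<le> norm (Q k) * norm x"
      using re_part_blinfun_le[of "Q k" x] by (simp add: T k)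
    also have "norm (Q k) \<le> ?q"
      using norm_le_onorm_on[OF Q_op k(1)] mult_left_mono[OF k(2) q0] by simp
    finally show ?thesis by (simp add: mult_right_mono)
  qed
  then have "bounded_operator scale UNIV UNIV T"
    by (auto simp: bounded_operator_def T_add T_scale)
  moreover have "T y = 0" if "y \<in> Y" for y
    by (rule eq_if_functionals_eq) (simp add: W_apply_Y[OF Q_W that] flip: T)
  moreover have "x - T x \<in> Y" for x
    by (simp add: Y_iff blinfun.diff_right W_dual Q_id flip: T)
  ultimately have along: "projection_along T" by (simp add: projection_along_def)
  moreover have "Q g = dual_map T g" if "g \<in> ?X'" for g
    by (rule blinfun_eqI) (simp add: dual_map_apply[OF along] T that)
  ultimately show ?thesis by (rule that)
qed

lemma projection_iff_complement_along:
  "projection scale Y UNIV P \<longleftrightarrow> projection_along (\<lambda>x. x - P x)"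
proof -
  have "bounded_operator scale UNIV UNIV (\<lambda>x. x - S x)" if "bounded_operator scale UNIV UNIV S" for S
    using that by (auto simp: bounded_operator_iff scale_right_diff_distrib
        intro: bounded_linear_sub bounded_linear_ident)
  from this[of P] this[of "\<lambda>x. x - P x"]
  have "bounded_operator scale UNIV UNIV P \<longleftrightarrow> bounded_operator scale UNIV UNIV (\<lambda>x. x - P x)" by auto
  then show ?thesis by (auto simp: projection_def projection_along_def bounded_operator_def)
qed

text \<open>
  The Daugavet equation for \<open>- T\<close>, which is compact because it vanishes on the subspace \<open>Y\<close> of finite codimension.
\<close>

lemma onorm_complement:
  assumes D: "daugavet_property scale" and nontrivial: "\<exists>x::'a. x \<noteq> 0" and T: "projection_along T"
  shows "onorm (\<lambda>x. x - T x) = 1 + onorm T"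
proof -
  have T_op: "bounded_operator scale UNIV UNIV T" and T0: "\<forall>y\<in>Y. T y = 0"
    using T by (auto simp: projection_along_def)
  have lin: "bounded_linear T" by (rule projection_along_bounded_linear[OF T])
  have op: "bounded_operator scale UNIV UNIV (\<lambda>x. - T x)"
    using T_op by (auto simp: bounded_operator_iff intro: bounded_linear_minus)
  have "\<exists>K. finite K \<and> (\<forall>x. norm x \<le> 1 \<longrightarrow> (\<exists>y\<in>K. norm (- T x - y) \<le> e))" if e: "0 < e" for e
  proof -
    define d where "d = e / (onorm T + 1)"
    have d: "0 < d" "d * onorm T \<le> e"
      using e onorm_pos_le[OF lin] by (auto simp: d_def field_simps)
    obtain U where U: "finite U"
      "\<And>x. norm x \<le> 1 \<Longrightarrow> \<exists>u\<in>U. \<forall>T. bounded_operator scale UNIV UNIV T \<longrightarrow> (\<forall>y\<in>Y. T y = 0) \<longrightarrow>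
        norm (T x - T u) \<le> d * onorm T"
      using finite_net_for_operators[OF d(1)] by metis
    have "\<exists>y\<in>(\<lambda>u. - T u) ` U. norm (- T x - y) \<le> e" if x: "norm x \<le> 1" for x
    proof -
      obtain u where "u \<in> U" "norm (T x - T u) \<le> d * onorm T" using U(2)[OF x] T_op T0 by blast
      then show ?thesis using d(2) by (intro bexI[of _ "- T u"]) (auto simp: norm_minus_commute)
    qed
    then show ?thesis using U(1) by (intro exI[of _ "(\<lambda>u. - T u) ` U"]) auto
  qed
  then have "onorm (\<lambda>x. x + - T x) = 1 + onorm (\<lambda>x. - T x)"
    by (rule Daugavet_compact_operator[OF D nontrivial op])
  then show ?thesis by (simp add: onorm_neg)
qed

text \<open>
  The quantity through which the two projection constants are compared. Both kinds of minimal
  projections correspond to operators \<open>T\<close> that attain this infimum.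
\<close>

definition least_norm :: real
  where "least_norm = Inf {onorm T |T. projection_along T}"

lemma projection_along_exists: "\<exists>T. projection_along T"
proof -
  obtain m g v where g: "\<And>i. i < m \<Longrightarrow> g i \<in> W" and "\<And>x. x - finite_rank m g v x \<in> Y"
    using finite_rank_resolution by blast
  then show ?thesis
    using bounded_operator_finite_rank[of m g v] W_dual finite_rank_zero_on_Y[OF g]
    by (auto simp: projection_along_def)
qed

lemma least_norm_le:
  assumes "projection_along T"
  shows "least_norm \<le> onorm T"
proof -
  have "bdd_below {onorm T |T. projection_along T}"
    by (rule bdd_belowI[of _ 0]) (auto intro: onorm_pos_le projection_along_bounded_linear)
  then show ?thesis unfolding least_norm_def by (rule cInf_lower[rotated]) (use assms in blast)
qed

lemma le_least_norm:
  assumes "\<And>T. projection_along T \<Longrightarrow> c \<le> onorm T"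
  shows "c \<le> least_norm"
  unfolding least_norm_def by (rule cInf_greatest) (use assms projection_along_exists in auto)

text \<open>
  The dual maps \<open>g \<mapsto> g \<circ> T\<close> are only some of the projections onto \<open>W\<close>, namely the weak* continuous ones,
  but by approximation the others do not lower the infimum.
\<close>

lemma projection_constant_dual: "projection_constant dual_scale W (dual_space scale) = least_norm"
  unfolding projection_constant_def
proof (rule cInf_eq_non_empty)
  show "{onorm_on (dual_space scale) Q |Q. projection dual_scale W (dual_space scale) Q} \<noteq> {}"
    using projection_along_exists projection_dual_map by blast
next
  fix x assume "x \<in> {onorm_on (dual_space scale) Q |Q. projection dual_scale W (dual_space scale) Q}"
  then obtain Q where Q: "projection dual_scale W (dual_space scale) Q" "x = onorm_on (dual_space scale) Q"
    by blast
  show "least_norm \<le> x"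
  proof (rule field_le_epsilon)
    fix e :: real assume "0 < e"
    then obtain T where "projection_along T" "onorm T \<le> x + e"
      using weak_star_continuous_approximation[OF Q(1)] Q(2) by blast
    then show "least_norm \<le> x + e" using least_norm_le by fastforce
  qed
next
  fix y assume y: "\<And>x. x \<in> {onorm_on (dual_space scale) Q |Q. projection dual_scale W (dual_space scale) Q} \<Longrightarrow> y \<le> x"
  show "y \<le> least_norm"
  proof (rule le_least_norm)
    fix T assume T: "projection_along T"
    then show "y \<le> onorm T" using y projection_dual_map[OF T] onorm_on_dual_map[OF T] by force
  qed
qed

lemma projection_constant_kernel:
  assumes D: "daugavet_property scale" and nontrivial: "\<exists>x::'a. x \<noteq> 0"
  shows "projection_constant scale Y UNIV = 1 + least_norm"
  unfolding projection_constant_def onorm_on_UNIV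
proof (rule cInf_eq_non_empty)
  have complement: "projection scale Y UNIV (\<lambda>x. x - T x)" if "projection_along T" for T
    using that by (simp add: projection_iff_complement_along)
  then show "{onorm P |P. projection scale Y UNIV P} \<noteq> {}" using projection_along_exists by blast
  show "1 + least_norm \<le> x" if x: "x \<in> {onorm P |P. projection scale Y UNIV P}" for x
  proof -
    obtain P where P: "projection_along (\<lambda>x. x - P x)" "x = onorm P"
      using x projection_iff_complement_along by blast
    then show ?thesis using onorm_complement[OF D nontrivial P(1)] least_norm_le[OF P(1)] by simp
  qed
  show "y \<le> 1 + least_norm" if y: "\<And>x. x \<in> {onorm P |P. projection scale Y UNIV P} \<Longrightarrow> y \<le> x" for y
  proof -
    have "y - 1 \<le> least_norm"
    proof (rule le_least_norm)
      fix T assume T: "projection_along T"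
      have "y \<le> onorm (\<lambda>x. x - T x)" using y complement[OF T] by blast
      then show "y - 1 \<le> onorm T" using onorm_complement[OF D nontrivial T] by simp
    qed
    then show ?thesis by simp
  qed
qed

lemma minimal_projection_kernel_iff:
  assumes D: "daugavet_property scale" and nontrivial: "\<exists>x::'a. x \<noteq> 0"
  shows "(\<exists>P. minimal_projection scale Y UNIV P) \<longleftrightarrow> (\<exists>T. projection_along T \<and> onorm T = least_norm)"
proof
  assume "\<exists>P. minimal_projection scale Y UNIV P"
  then obtain P where P: "projection_along (\<lambda>x. x - P x)" "onorm P = 1 + least_norm"
    by (auto simp: minimal_projection_def onorm_on_UNIV projection_iff_complement_along
        projection_constant_kernel[OF D nontrivial])
  then show "\<exists>T. projection_along T \<and> onorm T = least_norm"
    using onorm_complement[OF D nontrivial P(1)] by (intro exI[of _ "\<lambda>x. x - P x"]) simp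
next
  assume "\<exists>T. projection_along T \<and> onorm T = least_norm"
  then obtain T where T: "projection_along T" "onorm T = least_norm" by blast
  then show "\<exists>P. minimal_projection scale Y UNIV P"
    using onorm_complement[OF D nontrivial T(1)]
    by (intro exI[of _ "\<lambda>x. x - T x"])
      (simp add: minimal_projection_def onorm_on_UNIV projection_iff_complement_along
        projection_constant_kernel[OF D nontrivial])
qed

lemma minimal_projection_dual_iff:
  "(\<exists>Q. minimal_projection dual_scale W (dual_space scale) Q \<and> weak_star_continuous scale W Q) \<longleftrightarrow>
    (\<exists>T. projection_along T \<and> onorm T = least_norm)"
proof
  assume "\<exists>Q. minimal_projection dual_scale W (dual_space scale) Q \<and> weak_star_continuous scale W Q"
  then obtain Q where Q: "projection dual_scale W (dual_space scale) Q" "weak_star_continuous scale W Q"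
    "onorm_on (dual_space scale) Q = least_norm"
    by (auto simp: minimal_projection_def projection_constant_dual)
  obtain T where T: "projection_along T" "\<And>g. g \<in> dual_space scale \<Longrightarrow> Q g = dual_map T g"
    using weak_star_continuous_projection_is_dual_map[OF Q(1,2)] by metis
  have "onorm_on (dual_space scale) Q = onorm_on (dual_space scale) (dual_map T)"
    unfolding onorm_on_def by (rule SUP_cong) (simp_all add: T(2))
  then show "\<exists>T. projection_along T \<and> onorm T = least_norm"
    using T(1) Q(3) onorm_on_dual_map by auto
next
  assume "\<exists>T. projection_along T \<and> onorm T = least_norm"
  then obtain T where T: "projection_along T" "onorm T = least_norm" by blast
  then have "minimal_projection dual_scale W (dual_space scale) (dual_map T)"
    by (simp add: minimal_projection_def projection_constant_dual projection_dual_map onorm_on_dual_map)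
  then show "\<exists>Q. minimal_projection dual_scale W (dual_space scale) Q \<and> weak_star_continuous scale W Q"
    using dual_map_weak_star_continuous[OF T(1)] by blast
qed

end

theorem theorem1p1:
  fixes scale :: "'k::real_or_complex \<Rightarrow> 'a::banach \<Rightarrow> 'a"
    and f :: "nat \<Rightarrow> 'a \<Rightarrow>\<^sub>L 'k"
    and n :: nat
    and Y :: "'a set"
    and W :: "('a \<Rightarrow>\<^sub>L 'k) set"
  assumes "banach_space_over scale"
    and nonzero: "\<exists>x::'a. x \<noteq> 0"
    and "daugavet_property scale"
    and "\<forall>j\<in>{1..n}. f j \<in> dual_space scale"
    and "Y = (\<Inter>j\<in>{1..n}. {x. blinfun_apply (f j) x = 0})"
    and "W = module.span dual_scale (f ` {1..n})"
  shows "projection_constant scale Y UNIV =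
           1 + projection_constant dual_scale W (dual_space scale) \<and>
         ((\<exists>P. minimal_projection scale Y UNIV P) \<longleftrightarrow>
           (\<exists>Q. minimal_projection dual_scale W (dual_space scale) Q \<and>
                weak_star_continuous scale W Q))"
proof -
  interpret banach_space_over scale by fact
  interpret common_kernel scale "f ` {1..n}" Y W
    by unfold_locales (use assms(4-6) in auto)
  show ?thesis
    using projection_constant_kernel minimal_projection_kernel_iff projection_constant_dual
      minimal_projection_dual_iff nonzero \<open>daugavet_property scale\<close> by auto
qed

end
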